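(* Let $(A,\mathbf{B})$ be a noncommutative reality-based algebra of rank $7$ with positive degree map, and let $\chi$ be its (unique) irreducible character of degree $2$. If $\nu(\chi)=-1$, then the structure constants of the standard basis $\mathbf{B}$ are not all algebraic integers. In particular, no association scheme (via its adjacency algebra with the basis of adjacency matrices) is a rank $7$ noncommutative RBA with $\nu(\chi)=-1$.
   Context: A reality-based algebra (RBA) is a pair $(A,\mathbf{B})$ where $A$ is an associative unital $\mathbb{C}$-algebra with a skew-linear involution $*$, $\mathbf{B}=\{b_0=1_A,b_1,\dots,b_{r-1}\}$ is a $*$-invariant basis of $A$ ($r$ is the rank), the structure constants $\lambda_{ijk}$ defined by $b_ib_j=\sum_k\lambda_{ijk}b_k$ are real, and for each $i$, $b_i^*$ is the unique $b_j$ with $\lambda_{ij0}\neq0$, and $\lambda_{ii^*0}=\lambda_{i^*i0}>0$. It has a positive degree map if there is a $*$-algebra homomorphism $\delta:A\to\mathbb{C}$ with $\delta(b_i)>0$ for all $i$; $\mathbf{B}$ is the standard basis, normalized so that the coefficient of $1$ in $b_ib_i^*$ equals $\delta(b_i)$. The order is $n=\sum_i\delta(b_i)$; the standard feasible trace is $\tau(\sum_i\alpha_ib_i)=n\alpha_0$, decomposing as $\tau=\sum_{\psi\in\mathrm{Irr}(A)}m_\psi\psi$ with multiplicities $m_\psi>0$. A noncommutative semisimple algebra of dimension $7$ has irreducible characters of degrees $1,1,1,2$. The Frobenius–Schur indicator is $\nu(\psi)=\frac{m_\psi}{n\psi(b_0)}\sum_{i=0}^{r-1}\frac{\psi(b_i^2)}{\delta(b_i)}$,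 taking values in $\{-1,0,1\}$; $\nu(\psi)=0$ iff $\psi$ is not real-valued, and the number of real basis elements ($b_i^*=b_i$) equals $\sum_{\psi}\nu(\psi)\psi(b_0)$. *)

theory Defs
  imports "Jordan_Normal_Form.Matrix" "HOL-Computational_Algebra.Polynomial"
begin

(* An RBA of rank r is encoded by its structure constants lam i j k (b_i b_j = sum_k lam i j k b_k)
   with respect to the basis b_0 = 1, ..., b_(r-1) of A = C^r, together with the index map
   st (b_i^* = b_(st i)); the involution is the skew-linear extension of b_i |-> b_(st i). *)

definition is_RBA :: "nat \<Rightarrow> (nat \<Rightarrow> nat \<Rightarrow> nat \<Rightarrow> real) \<Rightarrow> (nat \<Rightarrow> nat) \<Rightarrow> bool" where
  "is_RBA r lam st \<longleftrightarrow>
     0 < r \<and>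
     (\<forall>j<r. \<forall>k<r. lam 0 j k = (if j = k then 1 else 0) \<and> lam j 0 k = (if j = k then 1 else 0)) \<and>
     (\<forall>i<r. \<forall>j<r. \<forall>l<r. \<forall>m<r.
        (\<Sum>k<r. lam i j k * lam k l m) = (\<Sum>k<r. lam j l k * lam i k m)) \<and>
     (\<forall>i<r. st i < r \<and> st (st i) = i) \<and>
     (\<forall>i<r. \<forall>j<r. \<forall>k<r. lam (st j) (st i) (st k) = lam i j k) \<and>
     (\<forall>i<r. \<forall>j<r. lam i j 0 \<noteq> 0 \<longleftrightarrow> j = st i) \<and>
     (\<forall>i<r. lam i (st i) 0 = lam (st i) i 0 \<and> lam i (st i) 0 > 0)"

definition noncommutative_RBA :: "nat \<Rightarrow> (nat \<Rightarrow> nat \<Rightarrow> nat \<Rightarrow> real) \<Rightarrow> bool" where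
  "noncommutative_RBA r lam \<longleftrightarrow> (\<exists>i<r. \<exists>j<r. \<exists>k<r. lam i j k \<noteq> lam j i k)"

definition positive_degree_map ::
  "nat \<Rightarrow> (nat \<Rightarrow> nat \<Rightarrow> nat \<Rightarrow> real) \<Rightarrow> (nat \<Rightarrow> nat) \<Rightarrow> (nat \<Rightarrow> real) \<Rightarrow> bool" where
  "positive_degree_map r lam st \<delta> \<longleftrightarrow>
     \<delta> 0 = 1 \<and>
     (\<forall>i<r. \<delta> i > 0) \<and>
     (\<forall>i<r. \<delta> (st i) = \<delta> i) \<and>
     (\<forall>i<r. \<forall>j<r. \<delta> i * \<delta> j = (\<Sum>k<r. lam i j k * \<delta> k))"

definition standard_basis ::
  "nat \<Rightarrow> (nat \<Rightarrow> nat \<Rightarrow> nat \<Rightarrow> real) \<Rightarrow> (nat \<Rightarrow> nat) \<Rightarrow> (nat \<Rightarrow> real) \<Rightarrow> bool" where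
  "standard_basis r lam st \<delta> \<longleftrightarrow> (\<forall>i<r. lam i (st i) 0 = \<delta> i)"

definition RBA_order :: "nat \<Rightarrow> (nat \<Rightarrow> real) \<Rightarrow> real" where
  "RBA_order r \<delta> = (\<Sum>i<r. \<delta> i)"

definition std_trace :: "nat \<Rightarrow> (nat \<Rightarrow> real) \<Rightarrow> nat \<Rightarrow> complex" where
  "std_trace r \<delta> i = (if i = 0 then of_real (RBA_order r \<delta>) else 0)"

definition is_rep ::
  "nat \<Rightarrow> (nat \<Rightarrow> nat \<Rightarrow> nat \<Rightarrow> real) \<Rightarrow> nat \<Rightarrow> (nat \<Rightarrow> complex mat) \<Rightarrow> bool" where
  "is_rep r lam d \<rho> \<longleftrightarrow>
     0 < d \<and>
     (\<forall>i<r. \<rho> i \<in> carrier_mat d d) \<and>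
     \<rho> 0 = 1\<^sub>m d \<and>
     (\<forall>i<r. \<forall>j<r. \<forall>a<d. \<forall>b<d.
        (\<rho> i * \<rho> j) $$ (a, b) = (\<Sum>k<r. complex_of_real (lam i j k) * \<rho> k $$ (a, b)))"

definition invariant_subspace :: "nat \<Rightarrow> nat \<Rightarrow> (nat \<Rightarrow> complex mat) \<Rightarrow> complex vec set \<Rightarrow> bool" where
  "invariant_subspace r d \<rho> W \<longleftrightarrow>
     W \<subseteq> carrier_vec d \<and> 0\<^sub>v d \<in> W \<and>
     (\<forall>v\<in>W. \<forall>w\<in>W. v + w \<in> W) \<and>
     (\<forall>c. \<forall>v\<in>W. c \<cdot>\<^sub>v v \<in> W) \<and>
     (\<forall>i<r. \<forall>v\<in>W. \<rho> i *\<^sub>v v \<in> W)"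

definition is_irrep ::
  "nat \<Rightarrow> (nat \<Rightarrow> nat \<Rightarrow> nat \<Rightarrow> real) \<Rightarrow> nat \<Rightarrow> (nat \<Rightarrow> complex mat) \<Rightarrow> bool" where
  "is_irrep r lam d \<rho> \<longleftrightarrow>
     is_rep r lam d \<rho> \<and>
     (\<forall>W. invariant_subspace r d \<rho> W \<longrightarrow> W = {0\<^sub>v d} \<or> W = carrier_vec d)"

definition character_of :: "nat \<Rightarrow> (nat \<Rightarrow> complex mat) \<Rightarrow> nat \<Rightarrow> complex" where
  "character_of r \<rho> i = (if i < r then (\<Sum>a<dim_row (\<rho> i). \<rho> i $$ (a, a)) else 0)"

definition Irr :: "nat \<Rightarrow> (nat \<Rightarrow> nat \<Rightarrow> nat \<Rightarrow> real) \<Rightarrow> (nat \<Rightarrow> complex) set" where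
  "Irr r lam = {\<psi>. \<exists>d \<rho>. is_irrep r lam d \<rho> \<and> \<psi> = character_of r \<rho>}"

definition multiplicity ::
  "nat \<Rightarrow> (nat \<Rightarrow> nat \<Rightarrow> nat \<Rightarrow> real) \<Rightarrow> (nat \<Rightarrow> real) \<Rightarrow> (nat \<Rightarrow> complex) \<Rightarrow> real" where
  "multiplicity r lam \<delta> =
     (THE m. (\<forall>\<psi>. \<psi> \<notin> Irr r lam \<longrightarrow> m \<psi> = 0) \<and>
             (\<forall>i<r. std_trace r \<delta> i = (\<Sum>\<psi>\<in>Irr r lam. complex_of_real (m \<psi>) * \<psi> i)))"

definition FS_indicator ::
  "nat \<Rightarrow> (nat \<Rightarrow> nat \<Rightarrow> nat \<Rightarrow> real) \<Rightarrow> (nat \<Rightarrow> real) \<Rightarrow> (nat \<Rightarrow> complex) \<Rightarrow> complex" where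
  "FS_indicator r lam \<delta> \<psi> =
     complex_of_real (multiplicity r lam \<delta> \<psi>) / (complex_of_real (RBA_order r \<delta>) * \<psi> 0) *
     (\<Sum>i<r. (\<Sum>k<r. complex_of_real (lam i i k) * \<psi> k) / complex_of_real (\<delta> i))"

definition algebraic_integer :: "real \<Rightarrow> bool" where
  "algebraic_integer x \<longleftrightarrow>
     (\<exists>p :: int poly. lead_coeff p = 1 \<and> poly (map_poly of_int p) x = 0)"

end

theory Submission
  imports Defs "Jordan_Normal_Form.Char_Poly"
begin

text \<open>
  Let \<open>R\<close> be a representation affording \<open>\<chi>\<close> and put \<open>\<kappa> = n/m\<^sub>\<chi>\<close>. Indicator \<open>-1\<close> makes the block
  of \<open>\<chi>\<close> quaternionic: \<open>R(b\<^sub>i\<^sup>*)\<close> is the adjugate of \<open>R(b\<^sub>i)\<close>, so \<open>\<chi>\<close> is real and the elements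
  \<open>b\<^sub>i - b\<^sub>i\<^sup>*\<close> act as pure quaternions. A trace count shows that they lie in this block and
  that no \<open>b\<^sub>i\<close> with \<open>i \<noteq> 0\<close> is real, so the basis is \<open>1\<close> together with three conjugate pairs.
  For \<open>b\<^sub>j\<close> outside the pair of \<open>b\<^sub>i\<close>, the coefficient of \<open>b\<^sub>j\<close> in \<open>b\<^sub>i (b\<^sub>j - b\<^sub>j\<^sup>*)\<close> is \<open>\<chi>(b\<^sub>i)/2\<close>.
  If the structure constants were algebraic integers, so would be the sum of \<open>\<chi>(b\<^sub>i)/2\<close> over
  representatives of the three pairs; but \<open>\<Sum>\<^sub>i \<chi>(b\<^sub>i) = 0\<close> and \<open>\<chi>(1) = 2\<close> force this sum to be
  \<open>-1/2\<close>.

  The indicator involves the multiplicity \<open>m\<^sub>\<chi>\<close>, which is only meaningful once \<open>\<tau>\<close> is known to be a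
  combination of irreducible characters. The blocks of \<open>\<chi>\<close> and of the degree map have a complement
  of dimension at most two; it is commutative without nilpotents and splits into common eigenvectors.
\<close>

subsection \<open>Algebraic integers\<close>

lemma algebraic_integer_iff_algebraic_int: "algebraic_integer x \<longleftrightarrow> algebraic_int x"
  unfolding algebraic_integer_def algebraic_int_altdef_ipoly by blast

lemma algebraic_int_eigenvalue:
  fixes x :: "'a :: field_char_0"
  assumes A: "(A :: int mat) \<in> carrier_mat n n" and "eigenvalue (map_mat of_int A) x"
  shows "algebraic_int x"
proof -
  have "poly (char_poly (map_mat of_int A)) x = 0"
    using assms by (subst eigenvalue_root_char_poly[symmetric]) auto
  hence "poly (map_poly of_int (char_poly A)) x = 0"
    using of_int_hom.char_poly_hom[OF A, where ?'a='a] by simp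
  moreover have "lead_coeff (char_poly A) = 1"
    using degree_monic_char_poly[OF A] by simp
  ultimately show ?thesis
    unfolding algebraic_int_altdef_ipoly by blast
qed

text \<open>The index set is arbitrary so that \<open>algebraic_int_add\<close> can index by pairs.
  A bijection with an initial segment turns \<open>M\<close> into an integer matrix, whose
  characteristic polynomial is monic.\<close>

lemma algebraic_int_eigenvector:
  fixes x :: "'a :: field_char_0" and v :: "'i \<Rightarrow> 'a"
  assumes "finite I" "i0 \<in> I" "v i0 \<noteq> 0"
    and ev: "\<And>i. i \<in> I \<Longrightarrow> x * v i = (\<Sum>j\<in>I. of_int (M i j) * v j)"
  shows "algebraic_int x"
proof -
  let ?n = "card I"
  from \<open>finite I\<close> obtain h where h: "bij_betw h {0..<?n} I"
    using ex_bij_betw_nat_finite by blast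
  define A where "A = mat ?n ?n (\<lambda>(a, b). M (h a) (h b))"
  define w where "w = vec ?n (\<lambda>a. v (h a))"
  have hI: "h a \<in> I" if "a < ?n" for a
    using h that by (auto simp: bij_betw_def)
  have "i0 \<in> h ` {0..<?n}"
    using h \<open>i0 \<in> I\<close> by (simp add: bij_betw_def)
  then obtain a0 where a0: "a0 < ?n" "h a0 = i0" by auto
  have "w $ a0 \<noteq> 0" using a0 assms by (simp add: w_def)
  hence "w \<noteq> 0\<^sub>v ?n" using a0 by auto
  moreover have "map_mat of_int A *\<^sub>v w = x \<cdot>\<^sub>v w"
  proof (rule eq_vecI)
    fix a assume "a < dim_vec (x \<cdot>\<^sub>v w)"
    hence a: "a < ?n" by (simp add: w_def)
    have "(map_mat of_int A *\<^sub>v w) $ a = (\<Sum>b\<in>{0..<?n}. of_int (M (h a) (h b)) * v (h b))"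
      using a by (simp add: A_def w_def scalar_prod_def)
    also have "\<dots> = (\<Sum>j\<in>I. of_int (M (h a) j) * v j)"
      by (rule sum.reindex_bij_betw[OF h])
    also have "\<dots> = x * v (h a)" using ev[OF hI[OF a]] by simp
    finally show "(map_mat of_int A *\<^sub>v w) $ a = (x \<cdot>\<^sub>v w) $ a"
      using a by (simp add: w_def)
  qed (simp add: A_def w_def)
  ultimately have "eigenvector (map_mat of_int A) w x"
    unfolding eigenvector_def by (simp add: A_def w_def)
  thus ?thesis
    by (intro algebraic_int_eigenvalue[of A ?n]) (auto simp: eigenvalue_def A_def)
qed

text \<open>The eigenvector is the vector of powers of \<open>x\<close>, and the matrix is the companion matrix.\<close>
lemma algebraic_int_obtain_eigenvector:
  fixes x :: "'a :: field_char_0"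
  assumes "algebraic_int x"
  obtains n :: nat and v :: "nat \<Rightarrow> 'a" and M
  where "n > 0" "v 0 = 1" "\<And>i. i < n \<Longrightarrow> x * v i = (\<Sum>j<n. of_int (M i j) * v j)"
proof -
  from assms obtain p where p: "poly (map_poly of_int p) x = 0" "lead_coeff (p :: int poly) = 1"
    unfolding algebraic_int_altdef_ipoly by blast
  define n where "n = degree p"
  have "n \<noteq> 0"
  proof
    assume "n = 0"
    then obtain c where "p = [:c:]" using degree_eq_zeroE[of p] unfolding n_def by blast
    with p show False by simp
  qed
  define M where "M i j = (if Suc i < n then of_bool (j = Suc i) else - coeff p j)" for i j
  have cf: "(\<Sum>j\<le>n. of_int (coeff p j) * x ^ j) = 0"
    using p by (simp add: poly_altdef n_def)
  have "x * x ^ i = (\<Sum>j<n. of_int (M i j) * x ^ j)" if "i < n" for i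
  proof (cases "Suc i < n")
    case True
    thus ?thesis by (simp add: M_def if_distrib sum.delta cong: if_cong)
  next
    case False
    with that have "n = Suc i" by simp
    moreover have "x ^ n = - (\<Sum>j<n. of_int (coeff p j) * x ^ j)"
      using cf p \<open>n \<noteq> 0\<close> unfolding lessThan_Suc_atMost[symmetric] sum.lessThan_Suc
      by (simp add: n_def eq_neg_iff_add_eq_0 add.commute)
    ultimately show ?thesis by (simp add: M_def sum_negf)
  qed
  thus ?thesis using that[of n "\<lambda>i. x ^ i" M] \<open>n \<noteq> 0\<close> by simp
qed

text \<open>The Kronecker sum of the two integer matrices has the tensor product of the two
  eigenvectors as eigenvector, with eigenvalue \<open>x + y\<close>; its entry at
  \<open>(0, 0)\<close> is 1.\<close>

lemma algebraic_int_add: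
  fixes x y :: "'a :: field_char_0"
  assumes "algebraic_int x" "algebraic_int y"
  shows "algebraic_int (x + y)"
proof -
  from assms(1) obtain n :: nat and v :: "nat \<Rightarrow> 'a" and M where
    x: "n > 0" "v 0 = 1" "\<And>i. i < n \<Longrightarrow> x * v i = (\<Sum>j<n. of_int (M i j) * v j)"
    by (rule algebraic_int_obtain_eigenvector) blast
  from assms(2) obtain m :: nat and w :: "nat \<Rightarrow> 'a" and N where
    y: "m > 0" "w 0 = 1" "\<And>i. i < m \<Longrightarrow> y * w i = (\<Sum>j<m. of_int (N i j) * w j)"
    by (rule algebraic_int_obtain_eigenvector) blast
  show ?thesis
  proof (rule algebraic_int_eigenvector[where I = "{..<n} \<times> {..<m}" and ?i0.0 = "(0, 0)"
        and v = "\<lambda>(a, b). v a * w b"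
        and M = "\<lambda>(a, b) (c, d). M a c * of_bool (b = d) + of_bool (a = c) * N b d"])
    fix i assume "i \<in> {..<n} \<times> {..<m}"
    then obtain a b where i: "i = (a, b)" "a < n" "b < m" by auto
    have "(\<Sum>j\<in>{..<n} \<times> {..<m}. of_int ((case i of (a, b) \<Rightarrow>
            \<lambda>(c, d). M a c * of_bool (b = d) + of_bool (a = c) * N b d) j) * (case j of (a, b) \<Rightarrow> v a * w b))
        = (\<Sum>c<n. \<Sum>d<m. of_int (M a c) * v c * (of_bool (b = d) * w d)
             + of_bool (a = c) * v c * (of_int (N b d) * w d))"
      unfolding sum.cartesian_product i by (intro sum.cong) (auto simp: algebra_simps)
    also have "\<dots> = (\<Sum>c<n. of_int (M a c) * v c) * w b + v a * (\<Sum>d<m. of_int (N b d) * w d)"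
    proof -
      have "(\<Sum>d<m. of_bool (b = d) * w d) = w b"
        using i by (simp add: of_bool_def if_distrib[of "\<lambda>z. z * _"] cong: if_cong)
      moreover have "(\<Sum>c<n. of_bool (a = c) * v c) = v a"
        using i by (simp add: of_bool_def if_distrib[of "\<lambda>z. z * _"] cong: if_cong)
      ultimately show ?thesis
        by (simp only: sum.distrib sum_product[symmetric])
    qed
    also have "\<dots> = (x + y) * (v a * w b)"
      using x(3)[OF i(2)] y(3)[OF i(3)] by (simp add: algebra_simps flip: x(3) y(3))
    finally show "(x + y) * (case i of (a, b) \<Rightarrow> v a * w b) = (\<Sum>j\<in>{..<n} \<times> {..<m}. of_int ((case i of (a, b) \<Rightarrow>
            \<lambda>(c, d). M a c * of_bool (b = d) + of_bool (a = c) * N b d) j) * (case j of (a, b) \<Rightarrow> v a * w b))"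
      by (simp add: i)
  qed (use x y in auto)
qed

lemma algebraic_int_diff:
  fixes x y :: "'a :: field_char_0"
  shows "algebraic_int x \<Longrightarrow> algebraic_int y \<Longrightarrow> algebraic_int (x - y)"
  using algebraic_int_add[of x "- y"] by simp

lemma algebraic_int_sum:
  fixes f :: "'i \<Rightarrow> 'a :: field_char_0"
  shows "(\<And>i. i \<in> I \<Longrightarrow> algebraic_int (f i)) \<Longrightarrow> algebraic_int (sum f I)"
  by (induction I rule: infinite_finite_induct) (auto intro: algebraic_int_add)

lemma not_algebraic_int_half: "\<not> algebraic_int (1 / 2 :: real)"
proof
  assume "algebraic_int (1 / 2 :: real)"
  hence "(1 / 2 :: real) \<in> \<int>" by (rule rational_algebraic_int_is_int) simp
  then obtain n :: int where "1 / 2 = real_of_int n" by (elim Ints_cases)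
  hence "1 = 2 * n" by linarith
  thus False by presburger
qed

subsection \<open>Linear algebra\<close>

lemma sum_of_bool_eq_left:
  fixes f :: "nat \<Rightarrow> 'a :: comm_ring_1"
  assumes "i < r"
  shows "(\<Sum>j<r. of_bool (j = i) * f j) = f i" "(\<Sum>j<r. of_bool (i = j) * f j) = f i"
    "(\<Sum>j<r. f j * of_bool (j = i)) = f i" "(\<Sum>j<r. f j * of_bool (i = j)) = f i"
proof -
  have 1: "of_bool (j = i) * f j = (if j = i then f j else 0)" "of_bool (i = j) * f j = (if j = i then f j else 0)"
    "f j * of_bool (j = i) = (if j = i then f j else 0)" "f j * of_bool (i = j) = (if j = i then f j else 0)" for j
    by auto
  show "(\<Sum>j<r. of_bool (j = i) * f j) = f i" "(\<Sum>j<r. of_bool (i = j) * f j) = f i"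
    "(\<Sum>j<r. f j * of_bool (j = i)) = f i" "(\<Sum>j<r. f j * of_bool (i = j)) = f i"
    unfolding 1 using assms by simp_all
qed

lemma sum_lessThan_two: "(\<Sum>b<2. f b) = f 0 + f (Suc 0)"
  by (simp add: numeral_2_eq_2)

lemma square_injective_imp_inverse:
  fixes H :: "nat \<Rightarrow> nat \<Rightarrow> complex"
  assumes "\<And>v. (\<And>a. a < d \<Longrightarrow> (\<Sum>b<d. H a b * v b) = 0) \<Longrightarrow> \<forall>b<d. v b = 0"
  shows "\<exists>N. (\<forall>a<d. \<forall>c<d. (\<Sum>b<d. H a b * N b c) = of_bool (a = c))
           \<and> (\<forall>a<d. \<forall>c<d. (\<Sum>b<d. N a b * H b c) = of_bool (a = c))"
proof -
  define A where "A = mat d d (\<lambda>(a, b). H a b)"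
  have A: "A \<in> carrier_mat d d" by (simp add: A_def)
  have "det A \<noteq> 0"
  proof
    assume "det A = 0"
    then obtain v where v: "v \<in> carrier_vec d" "v \<noteq> 0\<^sub>v d" "A *\<^sub>v v = 0\<^sub>v d"
      using det_0_iff_vec_prod_zero_field[OF A] by blast
    have "(\<Sum>b<d. H a b * v $ b) = 0" if "a < d" for a
    proof -
      have "(A *\<^sub>v v) $ a = 0" using v that by simp
      thus ?thesis using that v(1) by (simp add: A_def scalar_prod_def lessThan_atLeast0)
    qed
    hence "\<forall>b<d. v $ b = 0" by (rule assms)
    hence "v = 0\<^sub>v d" using v(1) by (intro eq_vecI) auto
    with v show False by simp
  qed
  from det_non_zero_imp_unit[OF A this, of "()"] obtain B where
    B: "B \<in> carrier_mat d d" "B * A = 1\<^sub>m d" "A * B = 1\<^sub>m d"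
    unfolding Units_def ring_mat_def by auto
  show ?thesis
  proof (intro exI[of _ "\<lambda>a b. B $$ (a, b)"] conjI allI impI)
    fix a c assume ac: "a < d" "c < d"
    have "(A * B) $$ (a, c) = of_bool (a = c)" using ac by (simp add: B)
    thus "(\<Sum>b<d. H a b * B $$ (b, c)) = of_bool (a = c)"
      using ac B(1) by (simp add: A_def scalar_prod_def lessThan_atLeast0)
  next
    fix a c assume ac: "a < d" "c < d"
    have "(B * A) $$ (a, c) = of_bool (a = c)" using ac by (simp add: B)
    thus "(\<Sum>b<d. B $$ (a, b) * H b c) = of_bool (a = c)"
      using ac B(1) by (simp add: A_def scalar_prod_def lessThan_atLeast0)
  qed
qed

text \<open>An invertible intertwiner makes \<open>P\<close> and \<open>Q\<close> conjugate. The
  sizes \<open>d\<close> and \<open>e\<close> are separate because Schur's lemma yields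
  \<open>M\<close> between representations whose degrees have not been compared.\<close>

lemma trace_eq_of_intertwiner:
  fixes P Q :: "nat \<Rightarrow> nat \<Rightarrow> complex"
  assumes int: "\<And>a c. a < d \<Longrightarrow> c < e \<Longrightarrow> (\<Sum>b<d. P a b * M b c) = (\<Sum>f<e. M a f * Q f c)"
    and MN: "\<And>a b. a < d \<Longrightarrow> b < d \<Longrightarrow> (\<Sum>c<e. M a c * N c b) = of_bool (a = b)"
    and NM: "\<And>a b. a < e \<Longrightarrow> b < e \<Longrightarrow> (\<Sum>c<d. N a c * M c b) = of_bool (a = b)"
  shows "(\<Sum>a<d. P a a) = (\<Sum>c<e. Q c c)"
proof -
  have "(\<Sum>a<d. P a a) = (\<Sum>a<d. \<Sum>b<d. P a b * (\<Sum>c<e. M b c * N c a))"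
    by (intro sum.cong refl) (simp add: MN sum_of_bool_eq_left)
  also have "\<dots> = (\<Sum>a<d. \<Sum>c<e. (\<Sum>b<d. P a b * M b c) * N c a)"
    by (rule sum.cong[OF refl], simp add: sum_distrib_left sum_distrib_right mult.assoc, rule sum.swap)
  also have "\<dots> = (\<Sum>a<d. \<Sum>c<e. \<Sum>f<e. N c a * M a f * Q f c)"
  proof (intro sum.cong refl)
    fix a c assume "a \<in> {..<d}" "c \<in> {..<e}"
    hence "(\<Sum>b<d. P a b * M b c) * N c a = (\<Sum>f<e. M a f * Q f c) * N c a" by (simp add: int)
    thus "(\<Sum>b<d. P a b * M b c) * N c a = (\<Sum>f<e. N c a * M a f * Q f c)"
      by (simp only: sum_distrib_right) (simp only: mult_ac)
  qed
  also have "\<dots> = (\<Sum>c<e. \<Sum>f<e. (\<Sum>a<d. N c a * M a f) * Q f c)"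
    by (rule trans[OF sum.swap], rule sum.cong[OF refl], simp only: sum_distrib_right, rule sum.swap)
  also have "\<dots> = (\<Sum>c<e. Q c c)"
    by (intro sum.cong refl) (simp add: NM sum_of_bool_eq_left)
  finally show ?thesis .
qed

lemma nontrivial_linear_relation:
  fixes w :: "nat \<Rightarrow> nat \<Rightarrow> complex"
  shows "\<exists>v. (\<exists>i<Suc N. v i \<noteq> 0) \<and> (\<forall>m<N. (\<Sum>i<Suc N. v i * w i m) = 0)"
proof (rule ccontr)
  assume no: "\<nexists>v. (\<exists>i<Suc N. v i \<noteq> 0) \<and> (\<forall>m<N. (\<Sum>i<Suc N. v i * w i m) = 0)"
  \<comment> \<open>Padding the \<open>N\<close> equations with a zero row gives a square matrix. If
    it were injective, row \<open>N\<close> of its product with the inverse would be zero and yet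
    have diagonal entry 1.\<close>
  define H where "H m i = (if m < N then w i m else 0)" for m i
  have "\<forall>b<Suc N. v b = 0" if v: "\<And>a. a < Suc N \<Longrightarrow> (\<Sum>b<Suc N. H a b * v b) = 0" for v
  proof -
    have "(\<Sum>i<Suc N. v i * w i m) = 0" if "m < N" for m
      using v[of m] that by (simp add: H_def mult.commute)
    thus ?thesis using no by blast
  qed
  from square_injective_imp_inverse[of "Suc N" H, OF this] obtain M where
    "\<forall>a<Suc N. \<forall>c<Suc N. (\<Sum>b<Suc N. H a b * M b c) = of_bool (a = c)" by blast
  hence "(\<Sum>b<Suc N. H N b * M b N) = 1" by simp
  thus False by (simp add: H_def)
qed

subsection \<open>Reality-based algebras\<close>

locale rba =
  fixes r :: nat and lam :: "nat \<Rightarrow> nat \<Rightarrow> nat \<Rightarrow> real" and st :: "nat \<Rightarrow> nat" and \<delta> :: "nat \<Rightarrow> real"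
  assumes is_RBA: "is_RBA r lam st"
    and degree_map: "positive_degree_map r lam st \<delta>"
    and standard: "standard_basis r lam st \<delta>"
begin

abbreviation c where "c i j k \<equiv> complex_of_real (lam i j k)"
abbreviation D where "D i \<equiv> complex_of_real (\<delta> i)"

lemma r_pos: "0 < r" and st_less [simp]: "i < r \<Longrightarrow> st i < r" and st_st [simp]: "i < r \<Longrightarrow> st (st i) = i"
  using is_RBA unfolding is_RBA_def by auto

lemma lam_one: "j < r \<Longrightarrow> k < r \<Longrightarrow> lam 0 j k = of_bool (j = k)"
    "j < r \<Longrightarrow> k < r \<Longrightarrow> lam j 0 k = of_bool (j = k)"
  using is_RBA unfolding is_RBA_def by auto

lemma lam_assoc: "i < r \<Longrightarrow> j < r \<Longrightarrow> l < r \<Longrightarrow> m < r \<Longrightarrow>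
    (\<Sum>k<r. lam i j k * lam k l m) = (\<Sum>k<r. lam j l k * lam i k m)"
  using is_RBA unfolding is_RBA_def by auto

lemma lam_star: "i < r \<Longrightarrow> j < r \<Longrightarrow> k < r \<Longrightarrow> lam (st j) (st i) (st k) = lam i j k"
  using is_RBA unfolding is_RBA_def by auto

lemma \<delta>_pos: "i < r \<Longrightarrow> \<delta> i > 0" and \<delta>_0 [simp]: "\<delta> 0 = 1" and \<delta>_st [simp]: "i < r \<Longrightarrow> \<delta> (st i) = \<delta> i"
  and \<delta>_mult: "i < r \<Longrightarrow> j < r \<Longrightarrow> \<delta> i * \<delta> j = (\<Sum>k<r. lam i j k * \<delta> k)"
  using degree_map unfolding positive_degree_map_def by auto

lemma \<delta>_nonzero: "i < r \<Longrightarrow> \<delta> i \<noteq> 0"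
  using \<delta>_pos[of i] by simp

lemma st_eq_iff: "i < r \<Longrightarrow> j < r \<Longrightarrow> st i = st j \<longleftrightarrow> i = j"
  by (metis st_st)

lemma lam_zero: "i < r \<Longrightarrow> j < r \<Longrightarrow> lam i j 0 = of_bool (j = st i) * \<delta> i"
  using is_RBA standard unfolding is_RBA_def standard_basis_def by auto

lemma st_0 [simp]: "st 0 = 0"
  using lam_one(1)[of 0 0] lam_zero[of 0 0] r_pos by (auto split: if_splits)

lemma sum_st: "(\<Sum>i<r. f (st i)) = (\<Sum>i<r. f i)"
  by (rule sum.reindex_bij_witness[of _ st st]) auto

text \<open>Both sides are the coefficient of \<open>1\<close> in \<open>b\<^sub>i b\<^sub>j b\<^sub>k\<close>.\<close>
lemma lam_cyclic:
  assumes "i < r" "j < r" "k < r"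
  shows "lam i j (st k) * \<delta> k = lam j k (st i) * \<delta> i"
proof -
  have "(\<Sum>l<r. lam i j l * lam l k 0) = (\<Sum>l<r. of_bool (l = st k) * (lam i j l * \<delta> l))"
    using assms by (intro sum.cong refl) (auto simp: lam_zero)
  moreover have "(\<Sum>l<r. lam j k l * lam i l 0) = (\<Sum>l<r. of_bool (l = st i) * (lam j k l * \<delta> i))"
    using assms by (intro sum.cong refl) (auto simp: lam_zero)
  ultimately show ?thesis
    using lam_assoc[of i j k 0] assms r_pos by (simp add: sum_of_bool_eq_left)
qed

lemma lam_rotate_left:
  assumes "i < r" "j < r" "k < r"
  shows "lam i j k / \<delta> i = lam j (st k) (st i) / \<delta> k"
  using lam_cyclic[of i j "st k"] assms \<delta>_nonzero by (simp add: field_simps)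

lemma lam_rotate_right:
  assumes "i < r" "j < r" "k < r"
  shows "lam i j k / \<delta> j = lam (st k) i (st j) / \<delta> k"
  using lam_cyclic[of "st k" i j] assms \<delta>_nonzero by (simp add: field_simps)

text \<open>Right multiplications by a basis element and by its star are adjoint for the trace form,
  in which the basis is orthogonal and the \<open>k\<close>-th element has square norm
  \<open>\<delta> k\<close>.\<close>

lemma lam_adjoint:
  assumes "i < r" "j < r" "k < r"
  shows "lam i j k / \<delta> i = lam k (st j) i / \<delta> k"
  using lam_rotate_left[OF assms] lam_star[of j "st k" "st i"] assms by simp

lemma c_rotate_left: "i < r \<Longrightarrow> j < r \<Longrightarrow> k < r \<Longrightarrow> c i j k / D i = c j (st k) (st i) / D k"
  using lam_rotate_left[of i j k] by (simp flip: of_real_divide)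

lemma c_rotate_right: "i < r \<Longrightarrow> j < r \<Longrightarrow> k < r \<Longrightarrow> c i j k / D j = c (st k) i (st j) / D k"
  using lam_rotate_right[of i j k] by (simp flip: of_real_divide)

lemma c_adjoint: "i < r \<Longrightarrow> j < r \<Longrightarrow> k < r \<Longrightarrow> c i j k / D i = c k (st j) i / D k"
  using lam_adjoint[of i j k] by (simp flip: of_real_divide)

subsection \<open>Representations and Schur's lemma\<close>

text \<open>Matrices are plain functions of two indices and only entries below \<open>d\<close> are
  constrained; \<open>Irr_matrix_form\<close> translates from \<open>is_irrep\<close>.\<close>

definition rep :: "nat \<Rightarrow> (nat \<Rightarrow> nat \<Rightarrow> nat \<Rightarrow> complex) \<Rightarrow> bool" where
  "rep d R \<longleftrightarrow> (\<forall>a<d. \<forall>b<d. R 0 a b = of_bool (a = b)) \<and>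
     (\<forall>i<r. \<forall>j<r. \<forall>a<d. \<forall>b<d. (\<Sum>e<d. R i a e * R j e b) = (\<Sum>k<r. c i j k * R k a b))"

definition irr :: "nat \<Rightarrow> (nat \<Rightarrow> nat \<Rightarrow> nat \<Rightarrow> complex) \<Rightarrow> bool" where
  "irr d R \<longleftrightarrow> 0 < d \<and> rep d R \<and>
     (\<forall>W. W \<subseteq> carrier_vec d \<and> 0\<^sub>v d \<in> W \<and> (\<forall>v\<in>W. \<forall>w\<in>W. v + w \<in> W) \<and>
       (\<forall>z. \<forall>v\<in>W. z \<cdot>\<^sub>v v \<in> W) \<and>
       (\<forall>i<r. \<forall>v\<in>W. vec d (\<lambda>a. \<Sum>b<d. R i a b * v $ b) \<in> W)
       \<longrightarrow> W = {0\<^sub>v d} \<or> W = carrier_vec d)"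

lemma rep_one: "rep d R \<Longrightarrow> a < d \<Longrightarrow> b < d \<Longrightarrow> R 0 a b = of_bool (a = b)"
  unfolding rep_def by blast

lemma rep_mult: "rep d R \<Longrightarrow> i < r \<Longrightarrow> j < r \<Longrightarrow> a < d \<Longrightarrow> b < d \<Longrightarrow>
    (\<Sum>e<d. R i a e * R j e b) = (\<Sum>k<r. c i j k * R k a b)"
  unfolding rep_def by blast

lemma irr_rep: "irr d R \<Longrightarrow> rep d R"
  unfolding irr_def by blast

lemma irr_subspace:
  assumes "irr d R" "W \<subseteq> carrier_vec d" "0\<^sub>v d \<in> W" "\<And>v w. v \<in> W \<Longrightarrow> w \<in> W \<Longrightarrow> v + w \<in> W"
    "\<And>z v. v \<in> W \<Longrightarrow> z \<cdot>\<^sub>v v \<in> W"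
    "\<And>i v. i < r \<Longrightarrow> v \<in> W \<Longrightarrow> vec d (\<lambda>a. \<Sum>b<d. R i a b * v $ b) \<in> W"
  shows "W = {0\<^sub>v d} \<or> W = carrier_vec d"
  by (rule mp[OF assms(1)[unfolded irr_def, THEN conjunct2, THEN conjunct2, THEN spec[of _ W]]])
     (use assms(2-) in simp)

text \<open>The kernel of \<open>M\<close> is invariant under \<open>Q\<close> and its image under
  \<open>R\<close>. The nonzero entry excludes the full kernel and the zero image, so
  \<open>M\<close> is bijective.\<close>

lemma schur_inverse:
  assumes R: "irr d R" and Q: "irr e Q"
    and int: "\<And>i a x. i < r \<Longrightarrow> a < d \<Longrightarrow> x < e \<Longrightarrow> (\<Sum>b<d. R i a b * M b x) = (\<Sum>f<e. M a f * Q i f x)"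
    and nz: "a0 < d" "x0 < e" "M a0 x0 \<noteq> 0"
  shows "\<exists>N. (\<forall>a<d. \<forall>b<d. (\<Sum>x<e. M a x * N x b) = of_bool (a = b))
           \<and> (\<forall>x<e. \<forall>y<e. (\<Sum>a<d. N x a * M a y) = of_bool (x = y))"
proof -
  define app where "app v = vec d (\<lambda>a. \<Sum>x<e. M a x * v $ x)" for v
  have app_Q: "(\<Sum>x<e. M a x * (\<Sum>f<e. Q i x f * v f)) = (\<Sum>b<d. R i a b * (\<Sum>x<e. M b x * v x))"
    if "i < r" "a < d" for i a and v :: "nat \<Rightarrow> complex"
  proof -
    have "(\<Sum>x<e. M a x * (\<Sum>f<e. Q i x f * v f)) = (\<Sum>f<e. (\<Sum>x<e. M a x * Q i x f) * v f)"
      by (simp add: sum_distrib_left sum_distrib_right mult.assoc) (rule sum.swap)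
    also have "\<dots> = (\<Sum>f<e. (\<Sum>b<d. R i a b * M b f) * v f)"
      using that by (simp add: int)
    also have "\<dots> = (\<Sum>b<d. R i a b * (\<Sum>x<e. M b x * v x))"
      by (simp add: sum_distrib_left sum_distrib_right mult.assoc) (rule sum.swap)
    finally show ?thesis .
  qed
  have app_unit: "app (unit_vec e x) $ a = M a x" if "x < e" "a < d" for x a
  proof -
    have "(\<Sum>y<e. M a y * unit_vec e x $ y) = (\<Sum>y<e. M a y * of_bool (y = x))"
      using that by (intro sum.cong refl) (auto simp: unit_vec_def)
    thus ?thesis using that by (simp add: app_def sum_of_bool_eq_left)
  qed
  define Ker where "Ker = {v \<in> carrier_vec e. app v = 0\<^sub>v d}"
  define Im where "Im = app ` carrier_vec e"
  have app_add: "app (v + w) = app v + app w" if "v \<in> carrier_vec e" "w \<in> carrier_vec e" for v w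
    using that by (intro eq_vecI) (auto simp: app_def distrib_left sum.distrib)
  have app_smult: "app (z \<cdot>\<^sub>v v) = z \<cdot>\<^sub>v app v" if "v \<in> carrier_vec e" for v z
    using that by (intro eq_vecI) (auto simp: app_def sum_distrib_left mult_ac)
  have app_act: "app (vec e (\<lambda>x. \<Sum>f<e. Q i x f * v $ f)) = vec d (\<lambda>a. \<Sum>b<d. R i a b * app v $ b)"
    if "i < r" for i v
    using that app_Q[OF that, of _ "\<lambda>x. v $ x"] by (intro eq_vecI) (auto simp: app_def)
  have app_0: "app (0\<^sub>v e) = 0\<^sub>v d"
    by (intro eq_vecI) (auto simp: app_def)
  have "Ker = {0\<^sub>v e} \<or> Ker = carrier_vec e"
  proof (rule irr_subspace[OF Q])
    fix i v assume "i < r" "v \<in> Ker"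
    thus "vec e (\<lambda>a. \<Sum>b<e. Q i a b * v $ b) \<in> Ker"
      by (auto simp: Ker_def app_act)
  qed (auto simp: Ker_def app_0 app_add app_smult)
  moreover have "unit_vec e x0 \<notin> Ker"
    using app_unit[OF nz(2,1)] nz by (auto simp: Ker_def)
  ultimately have Ker: "Ker = {0\<^sub>v e}" by auto
  have "Im = {0\<^sub>v d} \<or> Im = carrier_vec d"
  proof (rule irr_subspace[OF R])
    show "0\<^sub>v d \<in> Im" unfolding Im_def by (rule image_eqI[of _ _ "0\<^sub>v e"]) (simp_all add: app_0)
    fix v assume "v \<in> Im"
    then obtain v' where v': "v' \<in> carrier_vec e" "v = app v'" by (auto simp: Im_def)
    show "v + w \<in> Im" if "w \<in> Im" for w
      using that v' by (auto simp: Im_def simp flip: app_add)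
    show "z \<cdot>\<^sub>v v \<in> Im" for z
      using v' by (auto simp: Im_def simp flip: app_smult)
    show "vec d (\<lambda>a. \<Sum>b<d. R i a b * v $ b) \<in> Im" if "i < r" for i
      using v' that by (auto simp: Im_def simp flip: app_act)
  qed (auto simp: Im_def app_def)
  moreover have "app (unit_vec e x0) \<in> Im" "app (unit_vec e x0) \<noteq> 0\<^sub>v d"
    using app_unit[OF nz(2,1)] nz by (auto simp: Im_def)
  ultimately have Im: "Im = carrier_vec d" by auto
  have "\<exists>v. \<forall>a<d. (\<Sum>x<e. M a x * v x) = of_bool (a = b)" if "b < d" for b
  proof -
    have "unit_vec d b \<in> Im" by (simp add: Im)
    then obtain v where v: "unit_vec d b = app v" by (auto simp: Im_def)
    have "(\<Sum>x<e. M a x * v $ x) = of_bool (a = b)" if "a < d" for a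
    proof -
      have "(\<Sum>x<e. M a x * v $ x) = app v $ a" using that by (simp add: app_def)
      also have "\<dots> = unit_vec d b $ a" by (simp add: v)
      finally show ?thesis using that \<open>b < d\<close> by (auto simp: unit_vec_def)
    qed
    thus ?thesis by blast
  qed
  then obtain N where N: "\<And>a b. b < d \<Longrightarrow> a < d \<Longrightarrow> (\<Sum>x<e. M a x * N b x) = of_bool (a = b)"
    by metis
  \<comment> \<open>The right inverse is also a left inverse: \<open>M\<close> kills the difference
    of the \<open>y\<close>-th columns of the product and of the identity, and the kernel is
    zero.\<close>
  have "(\<Sum>a<d. N a x * M a y) = of_bool (x = y)" if "x < e" "y < e" for x y
  proof -
    define v where "v = vec e (\<lambda>x. (\<Sum>a<d. N a x * M a y) - of_bool (x = y))"
    have "app v = 0\<^sub>v d"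
    proof (rule eq_vecI)
      fix a assume a: "a < dim_vec (0\<^sub>v d)"
      have "app v $ a = (\<Sum>x<e. M a x * (\<Sum>b<d. N b x * M b y)) - (\<Sum>x<e. M a x * of_bool (x = y))"
        using a by (simp add: app_def v_def right_diff_distrib sum_subtractf)
      also have "(\<Sum>x<e. M a x * (\<Sum>b<d. N b x * M b y)) = (\<Sum>b<d. (\<Sum>x<e. M a x * N b x) * M b y)"
        by (simp add: sum_distrib_left sum_distrib_right mult.assoc) (rule sum.swap)
      also have "\<dots> = M a y" using a by (simp add: N sum_of_bool_eq_left)
      finally show "app v $ a = 0\<^sub>v d $ a" using a that by (simp add: sum_of_bool_eq_left)
    qed (simp add: app_def)
    hence "v \<in> Ker" by (simp add: Ker_def v_def)
    hence "v $ x = 0" using Ker that by simp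
    thus ?thesis using that by (simp add: v_def)
  qed
  with N show ?thesis by (intro exI[of _ "\<lambda>x b. N b x"]) auto
qed

text \<open>The averages \<open>\<Sum>\<^sub>i R\<^sub>i X Q\<^sub>i\<^sub>*/\<delta>\<^sub>i\<close> for \<open>X\<close> a matrix unit.\<close>
lemma average_intertwines:
  assumes R: "rep d R" and Q: "rep e Q" and "b < d" "f < e" "j < r" "a < d" "x < e"
  shows "(\<Sum>a'<d. R j a a' * (\<Sum>i<r. R i a' b * Q (st i) f x / D i))
       = (\<Sum>x'<e. (\<Sum>i<r. R i a b * Q (st i) f x' / D i) * Q j x' x)"
proof -
  have "(\<Sum>a'<d. R j a a' * (\<Sum>i<r. R i a' b * Q (st i) f x / D i))
      = (\<Sum>i<r. (\<Sum>a'<d. R j a a' * R i a' b) * Q (st i) f x / D i)"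
    by (simp add: sum_distrib_left sum_distrib_right sum_divide_distrib mult.assoc) (rule sum.swap)
  also have "\<dots> = (\<Sum>i<r. \<Sum>k<r. R k a b * (c j i k / D i) * Q (st i) f x)"
    using assms by (intro sum.cong refl, subst rep_mult[OF R])
      (simp_all add: sum_distrib_left sum_distrib_right sum_divide_distrib mult_ac)
  also have "\<dots> = (\<Sum>k<r. \<Sum>i<r. R k a b / D k * (c (st k) j (st i) * Q (st i) f x))"
    by (rule trans[OF sum.swap]) (intro sum.cong refl, use assms in \<open>simp add: c_rotate_right[of j]\<close>)
  also have "\<dots> = (\<Sum>k<r. R k a b / D k * (\<Sum>i<r. c (st k) j i * Q i f x))"
    by (simp only: sum_st[of "\<lambda>i. c _ j i * Q i f x"] flip: sum_distrib_left)
  also have "\<dots> = (\<Sum>k<r. R k a b / D k * (\<Sum>x'<e. Q (st k) f x' * Q j x' x))"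
    using assms by (intro sum.cong refl) (simp add: rep_mult)
  also have "\<dots> = (\<Sum>x'<e. (\<Sum>i<r. R i a b * Q (st i) f x' / D i) * Q j x' x)"
    by (simp add: sum_distrib_left sum_distrib_right mult.assoc) (rule sum.swap)
  finally show ?thesis .
qed

text \<open>A nonzero average would be an invertible intertwiner by Schur's lemma, and would force
  equal traces at \<open>j\<close>.\<close>

lemma irr_coefficients_orthogonal:
  assumes R: "irr d R" and Q: "irr e Q"
    and ne: "j < r" "(\<Sum>a<d. R j a a) \<noteq> (\<Sum>x<e. Q j x x)"
    and bd: "a < d" "b < d" "f < e" "x < e"
  shows "(\<Sum>i<r. R i a b * Q (st i) f x / D i) = 0"
proof (rule ccontr)
  define M where "M a x = (\<Sum>i<r. R i a b * Q (st i) f x / D i)" for a x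
  assume "(\<Sum>i<r. R i a b * Q (st i) f x / D i) \<noteq> 0"
  hence nz: "M a x \<noteq> 0" by (simp add: M_def)
  have int: "(\<Sum>b<d. R i a b * M b x) = (\<Sum>f<e. M a f * Q i f x)" if "i < r" "a < d" "x < e" for i a x
    unfolding M_def by (rule average_intertwines) (use that bd irr_rep[OF R] irr_rep[OF Q] in simp_all)
  obtain N where N: "\<forall>a<d. \<forall>b<d. (\<Sum>x<e. M a x * N x b) = of_bool (a = b)"
    "\<forall>x<e. \<forall>y<e. (\<Sum>a<d. N x a * M a y) = of_bool (x = y)"
    using schur_inverse[where R = R and Q = Q and M = M and d = d and e = e, OF R Q int bd(1,4) nz] by blast
  have "(\<Sum>a<d. R j a a) = (\<Sum>x<e. Q j x x)"
    by (rule trace_eq_of_intertwiner[where M = M and N = N]) (simp_all add: N int ne)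
  with ne(2) show False by simp
qed

lemma irr_characters_orthogonal:
  assumes R: "irr d R" and Q: "irr e Q"
    and ne: "j < r" "(\<Sum>a<d. R j a a) \<noteq> (\<Sum>x<e. Q j x x)"
  shows "(\<Sum>i<r. (\<Sum>a<d. R i a a) * (\<Sum>x<e. Q (st i) x x) / D i) = 0"
proof -
  have "(\<Sum>i<r. (\<Sum>a<d. R i a a) * (\<Sum>x<e. Q (st i) x x) / D i)
      = (\<Sum>i<r. \<Sum>a<d. \<Sum>x<e. R i a a * Q (st i) x x / D i)"
    by (simp only: sum_product sum_divide_distrib)
  also have "\<dots> = (\<Sum>a<d. \<Sum>x<e. \<Sum>i<r. R i a a * Q (st i) x x / D i)"
    by (rule trans[OF sum.swap], rule sum.cong[OF refl], rule sum.swap)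
  also have "\<dots> = 0"
    by (intro sum.neutral ballI irr_coefficients_orthogonal[where R = R and Q = Q and d = d and e = e and j = j])
       (use R Q ne in auto)
  finally show ?thesis .
qed

text \<open>\<open>R\<close> is unitary for the form \<open>H = \<Sum>\<^sub>i R\<^sub>i\<^sup>\<dagger> R\<^sub>i/\<delta>\<^sub>i\<close>, so that \<open>R\<^sub>i\<^sub>*\<close> is
  conjugate to the adjoint matrix of \<open>R\<^sub>i\<close>.\<close>
lemma rep_character_star:
  assumes R: "rep d R" and j: "j < r"
  shows "(\<Sum>a<d. R (st j) a a) = cnj (\<Sum>a<d. R j a a)"
proof -
  define H where "H a b = (\<Sum>i<r. \<Sum>e<d. cnj (R i e a) * R i e b / D i)" for a b
  have form: "(\<Sum>a<d. cnj (v a) * (\<Sum>b<d. H a b * v b))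
      = of_real (\<Sum>i<r. \<Sum>e<d. (cmod (\<Sum>a<d. R i e a * v a))\<^sup>2 / \<delta> i)" for v
  proof -
    have "of_real (\<Sum>i<r. \<Sum>e<d. (cmod (\<Sum>a<d. R i e a * v a))\<^sup>2 / \<delta> i)
       = (\<Sum>i<r. \<Sum>e<d. cnj (\<Sum>a<d. R i e a * v a) * (\<Sum>b<d. R i e b * v b) / D i)"
      by (simp add: complex_norm_square mult.commute flip: of_real_power)
    also have "\<dots> = (\<Sum>i<r. \<Sum>e<d. \<Sum>a<d. \<Sum>b<d. cnj (v a) * (cnj (R i e a) * R i e b / D i) * v b)"
      by (simp only: cnj_sum complex_cnj_mult sum_product sum_divide_distrib) (simp add: mult_ac)
    also have "\<dots> = (\<Sum>i<r. \<Sum>a<d. \<Sum>b<d. \<Sum>e<d. cnj (v a) * (cnj (R i e a) * R i e b / D i) * v b)"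
      by (rule sum.cong[OF refl], rule trans[OF sum.swap], rule sum.cong[OF refl], rule sum.swap)
    also have "\<dots> = (\<Sum>a<d. \<Sum>b<d. \<Sum>i<r. \<Sum>e<d. cnj (v a) * (cnj (R i e a) * R i e b / D i) * v b)"
      by (rule trans[OF sum.swap], rule sum.cong[OF refl], rule sum.swap)
    also have "\<dots> = (\<Sum>a<d. cnj (v a) * (\<Sum>b<d. H a b * v b))"
      by (simp add: H_def sum_distrib_left sum_distrib_right mult.assoc)
    finally show ?thesis by simp
  qed
  \<comment> \<open>The form is positive definite: its summand for the identity is already the
    squared length of \<open>v\<close>.\<close>
  have inj: "\<forall>b<d. v b = 0" if v: "\<And>a. a < d \<Longrightarrow> (\<Sum>b<d. H a b * v b) = 0" for v
  proof -
    have "complex_of_real (\<Sum>i<r. \<Sum>e<d. (cmod (\<Sum>a<d. R i e a * v a))\<^sup>2 / \<delta> i) = 0"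
      unfolding form[symmetric] using v by simp
    hence "(\<Sum>i<r. \<Sum>e<d. (cmod (\<Sum>a<d. R i e a * v a))\<^sup>2 / \<delta> i) = 0"
      by (simp only: of_real_eq_0_iff)
    moreover have "(\<Sum>e<d. (cmod (\<Sum>a<d. R i e a * v a))\<^sup>2 / \<delta> i) \<ge> 0" if "i < r" for i
      using \<delta>_pos[OF that] by (intro sum_nonneg) simp
    ultimately have "(\<Sum>e<d. (cmod (\<Sum>a<d. R 0 e a * v a))\<^sup>2 / \<delta> 0) = 0"
      using r_pos by (subst (asm) sum_nonneg_eq_0_iff) blast+
    hence "(\<Sum>e<d. (cmod (v e))\<^sup>2) = 0"
      using R by (simp add: rep_one sum_of_bool_eq_left)
    thus ?thesis by (subst (asm) sum_nonneg_eq_0_iff) auto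
  qed
  obtain N where N: "\<forall>a<d. \<forall>c<d. (\<Sum>b<d. H a b * N b c) = of_bool (a = c)"
      "\<forall>a<d. \<forall>c<d. (\<Sum>b<d. N a b * H b c) = of_bool (a = c)"
    using square_injective_imp_inverse[of d H, OF inj] by blast
  \<comment> \<open>Expand the product inside the conjugate, move the structure constant to the
    other factor by \<open>c_adjoint\<close>, and contract again.\<close>
  have "(\<Sum>b<d. cnj (R (st j) b a) * H b x) = (\<Sum>b<d. H a b * R j b x)" if "a < d" "x < d" for a x
  proof -
    have "(\<Sum>b<d. cnj (R (st j) b a) * H b x)
        = (\<Sum>b<d. \<Sum>i<r. \<Sum>e<d. cnj (R i e b * R (st j) b a) * R i e x / D i)"
      by (simp add: H_def sum_distrib_left mult_ac)
    also have "\<dots> = (\<Sum>i<r. \<Sum>e<d. cnj (\<Sum>b<d. R i e b * R (st j) b a) * R i e x / D i)"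
      by (rule trans[OF sum.swap], rule sum.cong[OF refl], rule trans[OF sum.swap])
         (simp add: sum_distrib_right sum_divide_distrib)
    also have "\<dots> = (\<Sum>i<r. \<Sum>e<d. \<Sum>k<r. (c i (st j) k / D i) * cnj (R k e a) * R i e x)"
      using that j by (intro sum.cong refl, subst rep_mult[OF R])
        (simp_all add: sum_distrib_left sum_distrib_right sum_divide_distrib mult_ac)
    also have "\<dots> = (\<Sum>i<r. \<Sum>e<d. \<Sum>k<r. (c k j i / D k) * cnj (R k e a) * R i e x)"
      using j by (intro sum.cong refl) (simp add: c_adjoint[of _ "st j"])
    also have "\<dots> = (\<Sum>i<r. \<Sum>k<r. \<Sum>e<d. (c k j i / D k) * cnj (R k e a) * R i e x)"
      by (rule sum.cong[OF refl], rule sum.swap)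
    also have "\<dots> = (\<Sum>k<r. \<Sum>e<d. cnj (R k e a) * (\<Sum>i<r. c k j i * R i e x) / D k)"
      by (rule trans[OF sum.swap], rule sum.cong[OF refl], rule trans[OF sum.swap])
         (simp add: sum_distrib_left sum_divide_distrib mult_ac)
    also have "\<dots> = (\<Sum>k<r. \<Sum>e<d. \<Sum>b<d. cnj (R k e a) * R k e b / D k * R j b x)"
      using that j by (intro sum.cong refl, subst rep_mult[OF R, symmetric])
        (simp_all add: sum_distrib_left sum_divide_distrib mult_ac)
    also have "\<dots> = (\<Sum>k<r. \<Sum>b<d. \<Sum>e<d. cnj (R k e a) * R k e b / D k * R j b x)"
      by (rule sum.cong[OF refl], rule sum.swap)
    also have "\<dots> = (\<Sum>b<d. H a b * R j b x)"
      by (rule trans[OF sum.swap]) (simp add: H_def sum_distrib_right)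
    finally show ?thesis .
  qed
  hence "(\<Sum>a<d. cnj (R (st j) a a)) = (\<Sum>a<d. R j a a)"
    by (rule trace_eq_of_intertwiner[where M = H and N = N]) (simp_all add: N)
  hence "cnj (\<Sum>a<d. R (st j) a a) = (\<Sum>a<d. R j a a)" by simp
  thus ?thesis by (metis complex_cnj_cnj)
qed

subsection \<open>Irreducible characters\<close>

text \<open>The vanishing from \<open>r\<close> on is recorded so that distinct characters are known
  to differ at an index below \<open>r\<close>, as \<open>Irr_orthogonal\<close> requires.\<close>

lemma Irr_matrix_form:
  assumes "\<psi> \<in> Irr r lam"
  shows "\<exists>d R. irr d R \<and> (\<forall>i<r. \<psi> i = (\<Sum>a<d. R i a a)) \<and> (\<forall>i\<ge>r. \<psi> i = 0)"
proof -
  from assms obtain d \<rho> where \<rho>: "is_irrep r lam d \<rho>" and \<psi>: "\<psi> = character_of r \<rho>"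
    unfolding Irr_def by blast
  from \<rho> have rep: "is_rep r lam d \<rho>"
    and sub: "invariant_subspace r d \<rho> W \<Longrightarrow> W = {0\<^sub>v d} \<or> W = carrier_vec d" for W
    unfolding is_irrep_def by blast+
  from rep have carrier: "\<And>i. i < r \<Longrightarrow> \<rho> i \<in> carrier_mat d d" and one: "\<rho> 0 = 1\<^sub>m d" and d: "0 < d"
    and mult: "\<And>i j a b. i < r \<Longrightarrow> j < r \<Longrightarrow> a < d \<Longrightarrow> b < d \<Longrightarrow>
        (\<rho> i * \<rho> j) $$ (a, b) = (\<Sum>k<r. c i j k * \<rho> k $$ (a, b))"
    unfolding is_rep_def by auto
  define R where "R i a b = \<rho> i $$ (a, b)" for i a b
  have repR: "rep d R"
    unfolding rep_def
  proof (intro conjI allI impI)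
    fix i j a b assume ij: "i < r" "j < r" and ab: "a < d" "b < d"
    have "(\<rho> i * \<rho> j) $$ (a, b) = (\<Sum>e<d. R i a e * R j e b)"
      using carrier[OF ij(1)] carrier[OF ij(2)] ab by (simp add: R_def scalar_prod_def lessThan_atLeast0)
    thus "(\<Sum>e<d. R i a e * R j e b) = (\<Sum>k<r. c i j k * R k a b)"
      using mult[OF ij ab] by (simp add: R_def)
  qed (simp add: R_def one)
  have subR: "W = {0\<^sub>v d} \<or> W = carrier_vec d"
    if W: "W \<subseteq> carrier_vec d \<and> 0\<^sub>v d \<in> W \<and> (\<forall>v\<in>W. \<forall>w\<in>W. v + w \<in> W) \<and> (\<forall>z. \<forall>v\<in>W. z \<cdot>\<^sub>v v \<in> W) \<and>
       (\<forall>i<r. \<forall>v\<in>W. vec d (\<lambda>a. \<Sum>b<d. R i a b * v $ b) \<in> W)" for W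
  proof (rule sub)
    have "\<rho> i *\<^sub>v v = vec d (\<lambda>a. \<Sum>b<d. R i a b * v $ b)" if "i < r" "v \<in> W" for i v
    proof -
      have "v \<in> carrier_vec d" using W that by blast
      thus ?thesis using carrier[OF that(1)]
        by (intro eq_vecI) (auto simp: R_def scalar_prod_def lessThan_atLeast0)
    qed
    thus "invariant_subspace r d \<rho> W" using W unfolding invariant_subspace_def by simp
  qed
  have "irr d R"
    unfolding irr_def by (intro conjI allI impI d repR) (rule subR)
  moreover have "\<psi> i = (\<Sum>a<d. R i a a)" if "i < r" for i
    using carrier[OF that] that by (simp add: \<psi> character_of_def R_def)
  moreover have "\<psi> i = 0" if "i \<ge> r" for i
    using that by (simp add: \<psi> character_of_def)
  ultimately show ?thesis by blast
qed

lemma linear_character_in_Irr: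
  assumes one: "\<phi> 0 = 1" and mult: "\<And>i j. i < r \<Longrightarrow> j < r \<Longrightarrow> \<phi> i * \<phi> j = (\<Sum>k<r. c i j k * \<phi> k)"
  shows "(\<lambda>i. if i < r then \<phi> i else 0) \<in> Irr r lam"
proof -
  define \<rho> where "\<rho> i = mat 1 1 (\<lambda>_. \<phi> i)" for i
  have "is_rep r lam 1 \<rho>"
    unfolding is_rep_def
  proof (intro conjI allI impI)
    show "\<rho> 0 = 1\<^sub>m 1" by (rule eq_matI) (auto simp: \<rho>_def one)
  qed (auto simp: \<rho>_def scalar_prod_def mult)
  moreover have "W = {0\<^sub>v 1} \<or> W = carrier_vec 1" if "invariant_subspace r 1 \<rho> W" for W
  proof (cases "W = {0\<^sub>v 1}")
    case False
    from that have W: "W \<subseteq> carrier_vec 1" "0\<^sub>v 1 \<in> W" "\<And>z v. v \<in> W \<Longrightarrow> z \<cdot>\<^sub>v v \<in> W"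
      unfolding invariant_subspace_def by auto
    from False W obtain v where v: "v \<in> W" "v \<noteq> 0\<^sub>v 1" by blast
    hence vc: "v \<in> carrier_vec 1" using W by blast
    have v0: "v $ 0 \<noteq> 0"
    proof
      assume "v $ 0 = 0"
      hence "v = 0\<^sub>v 1" using vc by (intro eq_vecI) auto
      with v show False by simp
    qed
    have "w \<in> W" if "w \<in> carrier_vec 1" for w
    proof -
      have "w = (w $ 0 / v $ 0) \<cdot>\<^sub>v v" using that vc v0 by (intro eq_vecI) auto
      thus ?thesis using W(3)[OF v(1)] by metis
    qed
    thus ?thesis using W by blast
  qed simp
  ultimately have "is_irrep r lam 1 \<rho>" unfolding is_irrep_def by blast
  moreover have "(\<lambda>i. if i < r then \<phi> i else 0) = character_of r \<rho>"
    by (auto simp: character_of_def \<rho>_def)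
  ultimately show ?thesis unfolding Irr_def by blast
qed

lemma degree_map_in_Irr: "(\<lambda>i. if i < r then D i else 0) \<in> Irr r lam"
proof (rule linear_character_in_Irr)
  fix i j assume "i < r" "j < r"
  from \<delta>_mult[OF this] have "complex_of_real (\<delta> i * \<delta> j) = of_real (\<Sum>k<r. lam i j k * \<delta> k)" by (rule arg_cong)
  thus "D i * D j = (\<Sum>k<r. c i j k * D k)" by simp
qed simp

lemma Irr_star:
  assumes "\<psi> \<in> Irr r lam" "i < r"
  shows "\<psi> (st i) = cnj (\<psi> i)"
proof -
  from Irr_matrix_form[OF assms(1)] obtain d R where R: "irr d R" "\<forall>i<r. \<psi> i = (\<Sum>a<d. R i a a)" by blast
  thus ?thesis using rep_character_star[OF irr_rep[OF R(1)] assms(2)] assms(2) by simp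
qed

lemma Irr_degree: 
  assumes "\<psi> \<in> Irr r lam"
  shows "\<exists>d>0. \<psi> 0 = of_nat d"
proof -
  from Irr_matrix_form[OF assms] obtain d R where R: "irr d R" "\<psi> 0 = (\<Sum>a<d. R 0 a a)"
    using r_pos by blast
  hence "\<psi> 0 = of_nat d" using rep_one[OF irr_rep[OF R(1)]] by simp
  moreover have "d > 0" using R(1) unfolding irr_def by blast
  ultimately show ?thesis by blast
qed

lemma Irr_orthogonal:
  assumes \<psi>: "\<psi> \<in> Irr r lam" and \<phi>: "\<phi> \<in> Irr r lam" and "\<psi> \<noteq> \<phi>"
  shows "(\<Sum>i<r. \<psi> i * cnj (\<phi> i) / D i) = 0"
proof -
  from Irr_matrix_form[OF \<psi>] obtain d R where
    R: "irr d R" "\<forall>i<r. \<psi> i = (\<Sum>a<d. R i a a)" "\<forall>i\<ge>r. \<psi> i = 0" by blast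
  from Irr_matrix_form[OF \<phi>] obtain e Q where
    Q: "irr e Q" "\<forall>i<r. \<phi> i = (\<Sum>a<e. Q i a a)" "\<forall>i\<ge>r. \<phi> i = 0" by blast
  from \<open>\<psi> \<noteq> \<phi>\<close> obtain j where "\<psi> j \<noteq> \<phi> j" by blast
  hence j: "j < r" "(\<Sum>a<d. R j a a) \<noteq> (\<Sum>x<e. Q j x x)"
    using R Q by (metis not_le)+
  have "cnj (\<phi> i) = (\<Sum>x<e. Q (st i) x x)" if "i < r" for i
    using Irr_star[OF \<phi> that] Q(2) that by (metis st_less)
  hence "(\<Sum>i<r. \<psi> i * cnj (\<phi> i) / D i) = (\<Sum>i<r. (\<Sum>a<d. R i a a) * (\<Sum>x<e. Q (st i) x x) / D i)"
    using R by (intro sum.cong refl) simp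
  also have "\<dots> = 0"
    by (rule irr_characters_orthogonal[where R = R and Q = Q and d = d and e = e and j = j])
       (use R Q j in auto)
  finally show ?thesis .
qed

section \<open>Norms of characters and multiplicities in the standard trace\<close>

definition sqnorm :: "(nat \<Rightarrow> complex) \<Rightarrow> real" where
  "sqnorm \<psi> = (\<Sum>i<r. (cmod (\<psi> i))\<^sup>2 / \<delta> i)"

lemma sqnorm_eq: "of_real (sqnorm \<psi>) = (\<Sum>i<r. \<psi> i * cnj (\<psi> i) / D i)"
  by (simp add: sqnorm_def complex_norm_square flip: of_real_power)

lemma sqnorm_ge: "(cmod (\<psi> 0))\<^sup>2 \<le> sqnorm \<psi>"
proof -
  have "(cmod (\<psi> 0))\<^sup>2 / \<delta> 0 \<le> sqnorm \<psi>"
    unfolding sqnorm_def using r_pos \<delta>_pos by (intro member_le_sum) (auto simp: less_imp_le)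
  thus ?thesis by simp
qed

lemma sqnorm_pos:
  assumes "\<psi> \<in> Irr r lam"
  shows "sqnorm \<psi> > 0"
proof -
  from Irr_degree[OF assms] have "cmod (\<psi> 0) > 0" by auto
  thus ?thesis using sqnorm_ge[of \<psi>] by (smt (verit) zero_less_power)
qed

abbreviation n where "n \<equiv> RBA_order r \<delta>"

lemma n_pos: "n > 0"
  unfolding RBA_order_def using r_pos \<delta>_pos by (intro sum_pos) auto

text \<open>The expansion uses a finite set \<open>F\<close> because finiteness of
  \<open>Irr r lam\<close> is only established inside \<open>multiplicity_eq\<close>.\<close>

definition Irr_span :: "(nat \<Rightarrow> complex) \<Rightarrow> bool" where
  "Irr_span g \<longleftrightarrow> (\<exists>F z. finite F \<and> F \<subseteq> Irr r lam \<and> (\<forall>i<r. g i = (\<Sum>\<psi>\<in>F. z \<psi> * \<psi> i)))"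

lemma Irr_span_zero: "(\<And>i. i < r \<Longrightarrow> g i = 0) \<Longrightarrow> Irr_span g"
  unfolding Irr_span_def by (rule exI[of _ "{}"]) simp

lemma Irr_span_scale_character:
  assumes "\<psi> \<in> Irr r lam" "\<And>i. i < r \<Longrightarrow> g i = z * \<psi> i"
  shows "Irr_span g"
  unfolding Irr_span_def using assms by (intro exI[of _ "{\<psi>}"] exI[of _ "\<lambda>_. z"]) simp

lemma Irr_span_add:
  assumes "Irr_span g" "Irr_span h" "\<And>i. i < r \<Longrightarrow> f i = g i + h i"
  shows "Irr_span f"
proof -
  from assms(1) obtain F z where F: "finite F" "F \<subseteq> Irr r lam" "\<And>i. i < r \<Longrightarrow> g i = (\<Sum>\<psi>\<in>F. z \<psi> * \<psi> i)"
    unfolding Irr_span_def by blast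
  from assms(2) obtain G w where G: "finite G" "G \<subseteq> Irr r lam" "\<And>i. i < r \<Longrightarrow> h i = (\<Sum>\<psi>\<in>G. w \<psi> * \<psi> i)"
    unfolding Irr_span_def by blast
  define y where "y \<psi> = of_bool (\<psi> \<in> F) * z \<psi> + of_bool (\<psi> \<in> G) * w \<psi>" for \<psi>
  have "f i = (\<Sum>\<psi>\<in>F \<union> G. y \<psi> * \<psi> i)" if "i < r" for i
  proof -
    have "(\<Sum>\<psi>\<in>F. z \<psi> * \<psi> i) = (\<Sum>\<psi>\<in>F \<union> G. of_bool (\<psi> \<in> F) * z \<psi> * \<psi> i)"
      using F G by (intro sum.mono_neutral_cong_left) auto
    moreover have "(\<Sum>\<psi>\<in>G. w \<psi> * \<psi> i) = (\<Sum>\<psi>\<in>F \<union> G. of_bool (\<psi> \<in> G) * w \<psi> * \<psi> i)"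
      using F G by (intro sum.mono_neutral_cong_left) auto
    ultimately show ?thesis
      using F(3) G(3) assms(3) that by (simp add: y_def distrib_right sum.distrib)
  qed
  thus ?thesis using F G unfolding Irr_span_def by (intro exI[of _ "F \<union> G"] exI[of _ y]) auto
qed

text \<open>Pairing \<open>\<tau>\<close> with any irreducible character gives a nonzero number, so every irreducible
  character occurs in every expansion of \<open>\<tau>\<close>; in particular there are finitely many of them.\<close>
lemma multiplicity_eq:
  assumes span: "Irr_span (std_trace r \<delta>)" and \<chi>: "\<chi> \<in> Irr r lam"
  shows "multiplicity r lam \<delta> \<chi> = n * Re (\<chi> 0) / sqnorm \<chi>"
proof -
  from span obtain F z where F: "finite F" "F \<subseteq> Irr r lam"
      "\<And>i. i < r \<Longrightarrow> std_trace r \<delta> i = (\<Sum>\<psi>\<in>F. z \<psi> * \<psi> i)"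
    unfolding Irr_span_def by blast
  have real: "complex_of_real (Re (\<phi> 0)) = \<phi> 0" "Re (\<phi> 0) > 0" if "\<phi> \<in> Irr r lam" for \<phi>
    using Irr_degree[OF that] by auto
  \<comment> \<open>Take the inner product of the expansion with \<open>\<phi>\<close>. The set
    \<open>G\<close> is arbitrary: first it is \<open>F\<close>, to show that \<open>F\<close>
    contains every irreducible character, then \<open>Irr r lam\<close> itself.\<close>
  have pair: "of_real (n * Re (\<phi> 0)) = (if \<phi> \<in> G then y \<phi> * of_real (sqnorm \<phi>) else 0)"
    if \<phi>: "\<phi> \<in> Irr r lam" and G: "finite G" "G \<subseteq> Irr r lam"
      "\<And>i. i < r \<Longrightarrow> std_trace r \<delta> i = (\<Sum>\<psi>\<in>G. y \<psi> * \<psi> i)" for \<phi> G y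
  proof -
    have "(\<Sum>i<r. std_trace r \<delta> i * cnj (\<phi> i) / D i) = (\<Sum>i<r. of_bool (i = 0) * (of_real n * cnj (\<phi> i) / D i))"
      by (intro sum.cong refl) (simp add: std_trace_def)
    also have "\<dots> = of_real n * cnj (\<phi> 0)" using r_pos by (subst sum_of_bool_eq_left) simp_all
    also have "cnj (\<phi> 0) = of_real (Re (\<phi> 0))" by (metis real(1)[OF \<phi>] complex_cnj_complex_of_real)
    finally have "of_real (n * Re (\<phi> 0)) = (\<Sum>i<r. std_trace r \<delta> i * cnj (\<phi> i) / D i)" by simp
    also have "\<dots> = (\<Sum>i<r. \<Sum>\<psi>\<in>G. y \<psi> * (\<psi> i * cnj (\<phi> i) / D i))"
      by (intro sum.cong refl) (simp add: G(3) sum_distrib_right sum_divide_distrib mult.assoc)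
    also have "\<dots> = (\<Sum>\<psi>\<in>G. y \<psi> * (\<Sum>i<r. \<psi> i * cnj (\<phi> i) / D i))"
      by (rule trans[OF sum.swap]) (simp add: sum_distrib_left)
    also have "\<dots> = (\<Sum>\<psi>\<in>G. if \<psi> = \<phi> then y \<phi> * of_real (sqnorm \<phi>) else 0)"
      using G(2) \<phi> by (intro sum.cong refl) (auto simp: Irr_orthogonal sqnorm_eq)
    finally show ?thesis using G(1) by simp
  qed
  have "\<phi> \<in> F" if "\<phi> \<in> Irr r lam" for \<phi>
    using pair[OF that F] real(2)[OF that] n_pos by (auto split: if_splits)
  hence IrrF: "Irr r lam = F" using F(2) by blast
  define m where "m \<psi> = (if \<psi> \<in> Irr r lam then n * Re (\<psi> 0) / sqnorm \<psi> else 0)" for \<psi>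
  \<comment> \<open>Every expansion has these real coefficients: for \<open>z\<close> this gives
    existence in the definite description, for \<open>m'\<close> uniqueness.\<close>
  have coeff: "y \<phi> = of_real (m \<phi>)"
    if \<phi>: "\<phi> \<in> Irr r lam" and y: "\<And>i. i < r \<Longrightarrow> std_trace r \<delta> i = (\<Sum>\<psi>\<in>Irr r lam. y \<psi> * \<psi> i)" for \<phi> y
    using pair[OF \<phi> _ subset_refl y] sqnorm_pos[OF \<phi>] F(1) \<phi>
    by (simp add: m_def IrrF field_simps)
  have "multiplicity r lam \<delta> = m"
    unfolding multiplicity_def
  proof (rule the_equality)
    show "(\<forall>\<psi>. \<psi> \<notin> Irr r lam \<longrightarrow> m \<psi> = 0) \<and>
        (\<forall>i<r. std_trace r \<delta> i = (\<Sum>\<psi>\<in>Irr r lam. complex_of_real (m \<psi>) * \<psi> i))"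
    proof (intro conjI allI impI)
      fix i assume i: "i < r"
      have "std_trace r \<delta> i = (\<Sum>\<psi>\<in>Irr r lam. z \<psi> * \<psi> i)" using F(3)[OF i] IrrF by simp
      also have "\<dots> = (\<Sum>\<psi>\<in>Irr r lam. complex_of_real (m \<psi>) * \<psi> i)"
        using coeff[of _ z] F(3) IrrF by (intro sum.cong refl) simp
      finally show "std_trace r \<delta> i = (\<Sum>\<psi>\<in>Irr r lam. complex_of_real (m \<psi>) * \<psi> i)" .
    qed (simp add: m_def)
  next
    fix m' assume m': "(\<forall>\<psi>. \<psi> \<notin> Irr r lam \<longrightarrow> m' \<psi> = 0) \<and>
        (\<forall>i<r. std_trace r \<delta> i = (\<Sum>\<psi>\<in>Irr r lam. complex_of_real (m' \<psi>) * \<psi> i))"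
    show "m' = m"
    proof
      fix \<psi> show "m' \<psi> = m \<psi>"
      proof (cases "\<psi> \<in> Irr r lam")
        case True
        have "complex_of_real (m' \<psi>) = of_real (m \<psi>)"
          using m' by (intro coeff[OF True, of "\<lambda>\<psi>. of_real (m' \<psi>)"]) blast
        thus ?thesis by simp
      qed (use m' in \<open>simp add: m_def\<close>)
    qed
  qed
  thus ?thesis using \<chi> by (simp add: m_def)
qed

subsection \<open>Irreducible representations of degree two\<close>

lemma all_less_two: "(\<forall>a<2. P a) \<longleftrightarrow> P 0 \<and> P (Suc 0)"
  by (auto simp: numeral_2_eq_2 less_Suc_eq)

text \<open>This is a root of the characteristic polynomial of the matrix with diagonal
  \<open>p\<close>, \<open>s\<close> and off-diagonal entries \<open>q\<close>,
  \<open>t\<close>.\<close>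

lemma complex_eigenvalue_2: "\<exists>\<mu> :: complex. (p - \<mu>) * (s - \<mu>) = q * t"
proof -
  define w where "w = csqrt ((p - s)\<^sup>2 + 4 * (q * t))"
  have w: "w\<^sup>2 = (p - s)\<^sup>2 + 4 * (q * t)" by (simp add: w_def)
  have "4 * ((p - (p + s + w) / 2) * (s - (p + s + w) / 2)) = w\<^sup>2 - (p - s)\<^sup>2"
    by (simp add: field_simps power2_eq_square)
  also have "\<dots> = 4 * (q * t)" using w by simp
  finally show ?thesis by (intro exI[of _ "(p + s + w) / 2"]) simp
qed

text \<open>Subtracting an eigenvalue from \<open>M\<close> leaves a singular matrix that still
  commutes with \<open>R\<close>; by Schur's lemma it is zero, since otherwise it would be
  invertible.\<close>

lemma irr_2_commuting_scalar:
  assumes R: "irr 2 R"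
    and comm: "\<And>i a x. i < r \<Longrightarrow> a < 2 \<Longrightarrow> x < 2 \<Longrightarrow> (\<Sum>b<2. R i a b * M b x) = (\<Sum>b<2. M a b * R i b x)"
    and "a < 2" "x < 2"
  shows "M a x = of_bool (a = x) * M 0 0"
proof -
  obtain \<mu> where \<mu>: "(M 0 0 - \<mu>) * (M 1 1 - \<mu>) = M 0 1 * M 1 0"
    using complex_eigenvalue_2 by blast
  define M' where "M' a x = M a x - of_bool (a = x) * \<mu>" for a x :: nat
  have zero: "M' a x = 0" if ax: "a < 2" "x < 2" for a x
  proof (rule ccontr)
    assume nz: "M' a x \<noteq> 0"
    have int: "(\<Sum>b<2. R i a b * M' b x) = (\<Sum>b<2. M' a b * R i b x)" if "i < r" "a < 2" "x < 2" for i a x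
    proof -
      have "a = 0 \<or> a = Suc 0" "x = 0 \<or> x = Suc 0" using that by auto
      thus ?thesis using comm[OF that]
        by (elim disjE) (simp_all add: M'_def sum_lessThan_two algebra_simps)
    qed
    obtain N where "\<forall>a<2. \<forall>b<2. (\<Sum>x<2. M' a x * N x b) = of_bool (a = b)"
      using schur_inverse[where R = R and Q = R and M = M' and d = 2 and e = 2, OF R R int ax nz] by blast
    hence "M' 0 0 * N 0 0 + M' 0 1 * N 1 0 = 1" "M' 0 0 * N 0 1 + M' 0 1 * N 1 1 = 0"
      "M' 1 0 * N 0 0 + M' 1 1 * N 1 0 = 0" "M' 1 0 * N 0 1 + M' 1 1 * N 1 1 = 1"
      by (simp_all add: all_less_two sum_lessThan_two)
    \<comment> \<open>Multiplicativity of the determinant, written out: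
      \<open>det M' * det N\<close> would be 1, but \<open>det M'\<close> is 0.\<close>
    hence "1 = (M' 0 0 * N 0 0 + M' 0 1 * N 1 0) * (M' 1 0 * N 0 1 + M' 1 1 * N 1 1)
        - (M' 0 0 * N 0 1 + M' 0 1 * N 1 1) * (M' 1 0 * N 0 0 + M' 1 1 * N 1 0)" by (simp only:) simp
    also have "\<dots> = (M' 0 0 * M' 1 1 - M' 0 1 * M' 1 0) * (N 0 0 * N 1 1 - N 0 1 * N 1 0)"
      by (simp add: algebra_simps)
    also have "\<dots> = 0" using \<mu> by (simp add: M'_def)
    finally show False by simp
  qed
  from zero[OF assms(3,4)] zero[of 0 0] show ?thesis by (simp add: M'_def)
qed

text \<open>For fixed \<open>b\<close>, \<open>e\<close> the average commutes with \<open>R\<close>,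
  hence is scalar in \<open>a\<close>, \<open>f\<close>. Substituting \<open>st i\<close> for
  \<open>i\<close> exchanges the two index pairs, so it is scalar in \<open>b\<close>,
  \<open>e\<close> as well.\<close>

lemma irr_2_schur_relation:
  assumes R: "irr 2 R"
  shows "\<exists>k. \<forall>a<2. \<forall>b<2. \<forall>e<2. \<forall>f<2.
    (\<Sum>i<r. R i a b * R (st i) e f / D i) = k * of_bool (a = f) * of_bool (b = e)"
proof -
  define T where "T b e a f = (\<Sum>i<r. R i a b * R (st i) e f / D i)" for a b e f
  have scalar: "T b e a f = of_bool (a = f) * T b e 0 0" if "b < 2" "e < 2" "a < 2" "f < 2" for a b e f
  proof (rule irr_2_commuting_scalar[OF R])
    fix i a x assume "i < r" "a < (2 :: nat)" "x < (2 :: nat)"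
    thus "(\<Sum>a'<2. R i a a' * T b e a' x) = (\<Sum>b'<2. T b e a b' * R i b' x)"
      unfolding T_def by (intro average_intertwines) (use that irr_rep[OF R] in simp_all)
  qed (use that in simp_all)
  have sym: "T b e a f = T f a e b" for a b e f
  proof -
    have "T b e a f = (\<Sum>i<r. R (st i) a b * R (st (st i)) e f / D (st i))"
      unfolding T_def by (rule sum_st[symmetric])
    also have "\<dots> = T f a e b" unfolding T_def by (intro sum.cong refl) (simp add: mult.commute)
    finally show ?thesis .
  qed
  have "T b e a f = T 0 0 0 0 * of_bool (a = f) * of_bool (b = e)" if "b < 2" "e < 2" "a < 2" "f < 2" for a b e f
  proof -
    have "T b e a f = of_bool (a = f) * T 0 0 e b" using scalar[OF that] sym[of b e 0 0] by simp
    also have "T 0 0 e b = of_bool (e = b) * T 0 0 0 0" using scalar[of 0 0 e b] that by simp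
    finally show ?thesis by auto
  qed
  thus ?thesis unfolding T_def by blast
qed

subsection \<open>The algebra in coordinates\<close>

definition mul :: "(nat \<Rightarrow> complex) \<Rightarrow> (nat \<Rightarrow> complex) \<Rightarrow> nat \<Rightarrow> complex" where
  "mul x y m = (if m < r then \<Sum>i<r. x i * (\<Sum>j<r. y j * c i j m) else 0)"

text \<open>Coefficients vanish from \<open>r\<close> on, so that equality of functions is equality
  in the algebra.\<close>

definition alg :: "(nat \<Rightarrow> complex) \<Rightarrow> bool" where
  "alg x \<longleftrightarrow> (\<forall>m\<ge>r. x m = 0)"

definition basis :: "nat \<Rightarrow> nat \<Rightarrow> complex" where
  "basis i m = of_bool (m = i)"

definition star :: "(nat \<Rightarrow> complex) \<Rightarrow> nat \<Rightarrow> complex" where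
  "star x m = (if m < r then cnj (x (st m)) else 0)"

lemma alg_mul [simp]: "alg (mul x y)" and alg_star [simp]: "alg (star x)"
  and alg_zero [simp]: "alg (\<lambda>_. 0)"
  by (auto simp: alg_def mul_def star_def)

lemma alg_combination [simp]: "alg x \<Longrightarrow> alg y \<Longrightarrow> alg (\<lambda>m. a * x m + b * y m)"
  by (simp add: alg_def)

lemma c_one: "j < r \<Longrightarrow> k < r \<Longrightarrow> c 0 j k = of_bool (j = k)"
  by (simp add: lam_one of_bool_def)

lemma c_zero: "i < r \<Longrightarrow> j < r \<Longrightarrow> c i j 0 = of_bool (j = st i) * D i"
  by (simp add: lam_zero of_bool_def)

lemma alg_eqI: "alg x \<Longrightarrow> alg y \<Longrightarrow> (\<And>m. m < r \<Longrightarrow> x m = y m) \<Longrightarrow> x = y"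
  unfolding alg_def by (intro ext) (metis not_le)

lemma mul_basis: "i < r \<Longrightarrow> m < r \<Longrightarrow> mul (basis i) y m = (\<Sum>j<r. y j * c i j m)"
  by (simp only: mul_def basis_def sum_of_bool_eq_left if_True)

lemma mul_eq_sum_basis: "m < r \<Longrightarrow> mul x y m = (\<Sum>i<r. x i * mul (basis i) y m)"
  by (simp add: mul_basis) (simp add: mul_def)

lemma mul_one: "alg x \<Longrightarrow> mul (basis 0) x = x"
  by (rule alg_eqI) (simp_all add: mul_basis r_pos c_one sum_of_bool_eq_left)

lemma mul_combination_left: "mul (\<lambda>m. a * x m + b * y m) z = (\<lambda>m. a * mul x z m + b * mul y z m)"
  by (auto simp: mul_def distrib_right sum.distrib sum_distrib_left mult.assoc)

lemma mul_combination_right: "mul z (\<lambda>m. a * x m + b * y m) = (\<lambda>m. a * mul z x m + b * mul z y m)"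
  by (auto simp: mul_def distrib_right distrib_left sum.distrib sum_distrib_left mult_ac)

lemma mul_zero_right: "mul z (\<lambda>_. 0) = (\<lambda>_. 0)"
  by (auto simp: mul_def)

lemma mul_basis_basis:
  assumes "i < r" "j < r" "m < r"
  shows "mul (basis i) (mul (basis j) z) m = (\<Sum>k<r. c i j k * mul (basis k) z m)"
proof -
  have assoc: "(\<Sum>k<r. c j l k * c i k m) = (\<Sum>k<r. c i j k * c k l m)" if "l < r" for l
    using arg_cong[OF lam_assoc[OF assms(1,2) that assms(3)], of complex_of_real] by simp
  have "mul (basis i) (mul (basis j) z) m = (\<Sum>k<r. (\<Sum>l<r. z l * c j l k) * c i k m)"
    using assms by (simp add: mul_basis)
  also have "\<dots> = (\<Sum>l<r. z l * (\<Sum>k<r. c j l k * c i k m))"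
    by (simp only: sum_distrib_right sum_distrib_left mult.assoc) (rule sum.swap)
  also have "\<dots> = (\<Sum>l<r. z l * (\<Sum>k<r. c i j k * c k l m))"
    by (simp add: assoc)
  also have "\<dots> = (\<Sum>k<r. c i j k * (\<Sum>l<r. z l * c k l m))"
    by (simp only: sum_distrib_left mult.left_commute[of "z _"]) (rule sum.swap)
  finally show ?thesis using assms by (simp add: mul_basis)
qed

lemma mul_assoc: "mul (mul x y) z = mul x (mul y z)"
proof (rule alg_eqI)
  fix m assume m: "m < r"
  have "mul (mul x y) z m = (\<Sum>k<r. (\<Sum>i<r. x i * (\<Sum>j<r. y j * c i j k)) * mul (basis k) z m)"
    using m by (simp add: mul_eq_sum_basis[of m "mul x y"]) (simp add: mul_def)
  also have "\<dots> = (\<Sum>i<r. x i * (\<Sum>k<r. (\<Sum>j<r. y j * c i j k) * mul (basis k) z m))"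
    by (simp only: sum_distrib_right[of _ "{..<r}" "mul (basis _) z m"] sum_distrib_left mult.assoc) (rule sum.swap)
  also have "\<dots> = (\<Sum>i<r. x i * (\<Sum>j<r. y j * (\<Sum>k<r. c i j k * mul (basis k) z m)))"
    by (rule sum.cong[OF refl], rule arg_cong[where f = "\<lambda>t. _ * t"],
        simp only: sum_distrib_right sum_distrib_left mult.assoc, rule sum.swap)
  also have "\<dots> = (\<Sum>i<r. x i * (\<Sum>j<r. y j * mul (basis i) (mul (basis j) z) m))"
    using m by (simp add: mul_basis_basis)
  also have "\<dots> = (\<Sum>i<r. x i * (\<Sum>j<r. y j * (\<Sum>k<r. mul (basis j) z k * c i k m)))"
    using m by (simp add: mul_basis[of _ m])
  also have "\<dots> = (\<Sum>i<r. x i * (\<Sum>k<r. mul y z k * c i k m))"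
    by (rule sum.cong[OF refl], rule arg_cong[where f = "\<lambda>t. _ * t"],
        simp add: mul_eq_sum_basis[of _ y z] sum_distrib_right sum_distrib_left mult.assoc, rule sum.swap)
  finally show "mul (mul x y) z m = mul x (mul y z) m" using m by (simp add: mul_def)
qed simp_all

lemma star_mul: "star (mul x y) = mul (star y) (star x)"
proof (rule alg_eqI)
  fix m assume m: "m < r"
  have "star (mul x y) m = (\<Sum>i<r. \<Sum>j<r. cnj (x i) * cnj (y j) * c i j (st m))"
    using m by (simp add: star_def mul_def sum_distrib_left mult.assoc)
  also have "\<dots> = (\<Sum>i<r. \<Sum>j<r. cnj (y j) * cnj (x i) * c (st j) (st i) m)"
    using m lam_star[of _ _ "st m"] by (intro sum.cong refl) simp
  also have "\<dots> = (\<Sum>j<r. \<Sum>i<r. cnj (y j) * cnj (x i) * c (st j) (st i) m)"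
    by (rule sum.swap)
  also have "\<dots> = (\<Sum>j<r. \<Sum>i<r. cnj (y (st (st j))) * cnj (x (st (st i))) * c (st j) (st i) m)"
    by (intro sum.cong refl) simp
  also have "\<dots> = (\<Sum>j<r. \<Sum>i<r. cnj (y (st j)) * cnj (x (st i)) * c j i m)"
    by (simp only: sum_st[of "\<lambda>i. cnj (y (st (st _))) * cnj (x (st i)) * c (st _) i m"]
        sum_st[of "\<lambda>j. \<Sum>i<r. cnj (y (st j)) * cnj (x (st i)) * c j i m"])
  finally show "star (mul x y) m = mul (star y) (star x) m"
    using m by (simp add: mul_def star_def sum_distrib_left mult.assoc)
qed simp_all

lemma star_star: "alg x \<Longrightarrow> star (star x) = x"
  by (rule alg_eqI) (auto simp: star_def)

text \<open>The coefficient of 1 in \<open>mul x (star x)\<close> is the sum of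
  \<open>(cmod (x i))\<^sup>2 * \<delta> i\<close>.\<close>

lemma mul_star_self_zero:
  assumes "alg x" "mul x (star x) = (\<lambda>_. 0)"
  shows "x = (\<lambda>_. 0)"
proof -
  have "(\<Sum>j<r. star x j * c i j 0) = (\<Sum>j<r. of_bool (j = st i) * (star x j * D i))" if "i < r" for i
    using that by (intro sum.cong refl) (simp add: c_zero)
  hence "mul x (star x) 0 = (\<Sum>i<r. x i * (\<Sum>j<r. of_bool (j = st i) * (star x j * D i)))"
    using r_pos by (simp add: mul_def)
  also have "\<dots> = of_real (\<Sum>i<r. (cmod (x i))\<^sup>2 * \<delta> i)"
    by (simp add: sum_of_bool_eq_left star_def complex_norm_square mult.assoc flip: of_real_power)
  finally have "(\<Sum>i<r. (cmod (x i))\<^sup>2 * \<delta> i) = 0"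
    using assms(2) by (metis of_real_eq_0_iff)
  moreover have "(cmod (x i))\<^sup>2 * \<delta> i \<ge> 0" if "i < r" for i
    using \<delta>_pos[OF that] by simp
  ultimately have "\<forall>i<r. (cmod (x i))\<^sup>2 * \<delta> i = 0"
    by (subst (asm) sum_nonneg_eq_0_iff) auto
  hence zero: "x i = 0" if "i < r" for i using \<delta>_nonzero[OF that] that by auto
  show ?thesis by (rule alg_eqI) (simp_all add: assms(1) zero)
qed

text \<open>For \<open>w = mul v (star v)\<close>, normality turns \<open>mul w (star w)\<close>
  into \<open>v\<close> squared times \<open>star v\<close> squared, which is zero. Positivity then
  gives \<open>w = 0\<close>, and again \<open>v = 0\<close>.\<close>

lemma normal_nilpotent_zero:
  assumes v: "alg v" "mul v v = (\<lambda>_. 0)" and normal: "mul v (star v) = mul (star v) v"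
  shows "v = (\<lambda>_. 0)"
proof -
  let ?w = "mul v (star v)"
  have "mul ?w (star ?w) = mul v (mul (star v) (mul v (star v)))"
    using v by (simp add: star_mul star_star mul_assoc)
  also have "mul (star v) (mul v (star v)) = mul v (mul (star v) (star v))"
    by (metis mul_assoc normal)
  also have "mul v (mul v (mul (star v) (star v))) = mul (mul v v) (mul (star v) (star v))"
    by (simp add: mul_assoc)
  also have "\<dots> = (\<lambda>_. 0)" by (auto simp: v mul_def)
  finally have "?w = (\<lambda>_. 0)" by (rule mul_star_self_zero[rotated]) simp
  with v(1) show ?thesis by (rule mul_star_self_zero)
qed

text \<open>The eigenvalues of the left multiplications on a common eigenvector are multiplicative
  in the basis element, hence form a linear character.\<close>

lemma eigenvector_character_in_Irr:
  assumes v: "alg v" "v \<noteq> (\<lambda>_. 0)"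
    and ev: "\<And>i. i < r \<Longrightarrow> mul (basis i) v = (\<lambda>m. \<phi> i * v m)"
  shows "(\<lambda>i. if i < r then \<phi> i else 0) \<in> Irr r lam"
proof (rule linear_character_in_Irr)
  from v obtain m where m: "v m \<noteq> 0" by auto
  have mr: "m < r" by (rule ccontr) (use v(1) m in \<open>simp add: alg_def\<close>)
  show "\<phi> 0 = 1"
    using fun_cong[OF ev[OF r_pos], of m] m by (simp add: mul_one v)
  fix i j assume ij: "i < r" "j < r"
  have "mul (basis i) (mul (basis j) v) = (\<lambda>m. \<phi> j * (\<phi> i * v m))"
    using mul_combination_right[of "basis i" "\<phi> j" v 0 v] by (simp add: ev ij)
  hence "\<phi> j * (\<phi> i * v m) = (\<Sum>k<r. c i j k * \<phi> k) * v m"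
    using mul_basis_basis[OF ij mr, of v] by (simp add: ev sum_distrib_right mult.assoc)
  hence "\<phi> i * \<phi> j * v m = (\<Sum>k<r. c i j k * \<phi> k) * v m"
    by (metis mult.assoc mult.commute)
  thus "\<phi> i * \<phi> j = (\<Sum>k<r. c i j k * \<phi> k)" by (rule iffD1[OF mult_right_cancel[OF m]])
qed

end

section \<open>The block of an irreducible character of degree two\<close>

locale rba_two = rba +
  fixes R :: "nat \<Rightarrow> nat \<Rightarrow> nat \<Rightarrow> complex" and \<chi> :: "nat \<Rightarrow> complex" and \<kappa> :: real
  assumes irr_R: "irr 2 R"
    and \<chi>_Irr: "\<chi> \<in> Irr r lam"
    and \<chi>_eq: "\<And>i. i < r \<Longrightarrow> \<chi> i = (\<Sum>a<2. R i a a)"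
    and \<kappa>_pos: "\<kappa> > 0"
    and schur: "\<And>a b e f. a < 2 \<Longrightarrow> b < 2 \<Longrightarrow> e < 2 \<Longrightarrow> f < 2 \<Longrightarrow>
      (\<Sum>i<r. R i a b * R (st i) e f / D i) = of_real \<kappa> * of_bool (a = f) * of_bool (b = e)"

text \<open>Summing the Schur relation over \<open>a = b\<close> and \<open>e = f\<close> gives
  \<open>sqnorm \<chi> = 2 * k\<close>, so the Schur constant is real and positive.\<close>

lemma (in rba) rba_two_exists:
  assumes \<chi>: "\<chi> \<in> Irr r lam" "\<chi> 0 = 2"
  shows "\<exists>R. rba_two r lam st \<delta> R \<chi> (sqnorm \<chi> / 2)"
proof -
  from Irr_matrix_form[OF \<chi>(1)] obtain d R where R: "irr d R" "\<forall>i<r. \<chi> i = (\<Sum>a<d. R i a a)" by blast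
  have "of_nat d = (2 :: complex)"
    using R(2) r_pos rep_one[OF irr_rep[OF R(1)]] \<chi>(2) by simp
  hence d: "d = 2" by (metis of_nat_eq_iff of_nat_numeral)
  note R = R[unfolded d]
  from irr_2_schur_relation[OF R(1)] obtain k where k: "\<And>a b e f. a < 2 \<Longrightarrow> b < 2 \<Longrightarrow> e < 2 \<Longrightarrow> f < 2 \<Longrightarrow>
    (\<Sum>i<r. R i a b * R (st i) e f / D i) = k * of_bool (a = f) * of_bool (b = e)" by blast
  have "cnj (\<chi> i) = (\<Sum>e<2. R (st i) e e)" if "i < r" for i
    using Irr_star[OF \<chi>(1) that] R(2) that by (metis st_less)
  hence "of_real (sqnorm \<chi>) = (\<Sum>i<r. (\<Sum>a<2. R i a a) * (\<Sum>e<2. R (st i) e e) / D i)"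
    unfolding sqnorm_eq using R(2) by (intro sum.cong refl) simp
  also have "\<dots> = (\<Sum>i<r. R i 0 0 * R (st i) 0 0 / D i) + (\<Sum>i<r. R i 0 0 * R (st i) (Suc 0) (Suc 0) / D i)
     + (\<Sum>i<r. R i (Suc 0) (Suc 0) * R (st i) 0 0 / D i) + (\<Sum>i<r. R i (Suc 0) (Suc 0) * R (st i) (Suc 0) (Suc 0) / D i)"
    by (simp add: sum_lessThan_two distrib_left distrib_right add_divide_distrib sum.distrib)
  also have "\<dots> = 2 * k" by (simp add: k)
  finally have "k = of_real (sqnorm \<chi> / 2)" by simp
  with R k \<chi> sqnorm_pos[OF \<chi>(1)] show ?thesis
    by (intro exI[of _ R]) (unfold_locales, simp_all)
qed

context rba_two begin

lemma \<kappa>_nonzero [simp]: "\<kappa> \<noteq> 0" and n_nonzero [simp]: "n \<noteq> 0"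
  using \<kappa>_pos n_pos by simp_all

lemma R_one: "a < 2 \<Longrightarrow> b < 2 \<Longrightarrow> R 0 a b = of_bool (a = b)"
  by (rule rep_one[OF irr_rep[OF irr_R]])

lemma R_mult: "i < r \<Longrightarrow> j < r \<Longrightarrow> a < 2 \<Longrightarrow> b < 2 \<Longrightarrow> (\<Sum>e<2. R i a e * R j e b) = (\<Sum>k<r. c i j k * R k a b)"
  by (rule rep_mult[OF irr_rep[OF irr_R]])

lemma \<chi>_0: "\<chi> 0 = 2"
  using \<chi>_eq[OF r_pos] by (simp add: R_one sum_lessThan_two)

lemma sum_R_eq_0:
  assumes "a < 2" "b < 2"
  shows "(\<Sum>i<r. R i a b) = 0"
proof -
  from Irr_matrix_form[OF degree_map_in_Irr] obtain d Q where
    Q: "irr d Q" "\<And>i. i < r \<Longrightarrow> (if i < r then D i else 0) = (\<Sum>a<d. Q i a a)" by blast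
  have "of_nat d = (1 :: complex)"
    using Q(2)[OF r_pos] r_pos rep_one[OF irr_rep[OF Q(1)]] by simp
  hence d: "d = 1" by (metis of_nat_eq_1_iff)
  have QD: "Q i 0 0 = D i" if "i < r" for i using Q(2)[OF that] that by (simp add: d)
  have "(\<Sum>i<r. R i a b * Q (st i) 0 0 / D i) = 0"
    \<comment> \<open>The characters differ already at \<open>j = 0\<close>, where their values are
      2 and 1.\<close>
    by (rule irr_coefficients_orthogonal[where R = R and Q = Q and d = 2 and e = 1 and j = 0])
       (use irr_R Q(1) d assms r_pos in \<open>simp_all add: QD R_one\<close>)
  moreover have "(\<Sum>i<r. R i a b * Q (st i) 0 0 / D i) = (\<Sum>i<r. R i a b)"
    by (intro sum.cong refl) (simp add: QD \<delta>_nonzero)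
  ultimately show ?thesis by simp
qed

lemma sum_R_star_eq_0: "a < 2 \<Longrightarrow> b < 2 \<Longrightarrow> (\<Sum>i<r. R (st i) a b) = 0"
  using sum_R_eq_0 sum_st[of "\<lambda>i. R i a b"] by simp

lemma sum_\<chi>_eq_0: "(\<Sum>i<r. \<chi> i) = 0"
  by (simp add: \<chi>_eq sum_lessThan_two sum.distrib sum_R_eq_0)

definition ev :: "(nat \<Rightarrow> complex) \<Rightarrow> nat \<Rightarrow> nat \<Rightarrow> complex" where
  "ev x a b = (\<Sum>i<r. x i * R i a b)"

text \<open>The common kernel of \<open>R\<close> and the degree map; in rank 7 its dimension is at
  most two by \<open>ideal_dependent\<close>.\<close>

definition ideal :: "(nat \<Rightarrow> complex) \<Rightarrow> bool" where
  "ideal x \<longleftrightarrow> alg x \<and> (\<forall>a<2. \<forall>b<2. ev x a b = 0) \<and> (\<Sum>i<r. x i * D i) = 0"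

lemma ideal_combination: "ideal x \<Longrightarrow> ideal y \<Longrightarrow> ideal (\<lambda>m. p * x m + q * y m)"
  by (auto simp: ideal_def ev_def distrib_right sum.distrib mult.assoc simp flip: sum_distrib_left)

lemma ideal_mul_basis:
  assumes "ideal x" "i < r"
  shows "ideal (mul (basis i) x)"
proof -
  have "(\<Sum>k<r. mul (basis i) x k * g k) = (\<Sum>j<r. x j * (\<Sum>k<r. c i j k * g k))" for g
    using assms(2) by (simp add: mul_basis sum_distrib_left sum_distrib_right mult.assoc) (rule sum.swap)
  note * = this
  have "ev (mul (basis i) x) a b = 0" if ab: "a < 2" "b < 2" for a b
  proof -
    have "ev (mul (basis i) x) a b = (\<Sum>j<r. x j * (\<Sum>e<2. R i a e * R j e b))"
      unfolding ev_def * using assms(2) ab by (simp add: R_mult)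
    also have "\<dots> = (\<Sum>e<2. R i a e * ev x e b)"
      unfolding ev_def by (simp only: sum_distrib_left mult.left_commute) (rule sum.swap)
    also have "\<dots> = 0" using assms(1) ab by (simp add: ideal_def)
    finally show ?thesis .
  qed
  moreover have "(\<Sum>k<r. mul (basis i) x k * D k) = 0"
  proof -
    have "(\<Sum>k<r. c i j k * D k) = D i * D j" if "j < r" for j
      using arg_cong[OF \<delta>_mult[OF assms(2) that], of complex_of_real] by simp
    hence "(\<Sum>k<r. mul (basis i) x k * D k) = (\<Sum>j<r. D i * (x j * D j))"
      unfolding * by (intro sum.cong refl) (simp add: mult_ac)
    thus ?thesis using assms(1) by (simp add: ideal_def flip: sum_distrib_left)
  qed
  ultimately show ?thesis by (simp add: ideal_def)
qed

text \<open>The eight vectors consist of the three given ones, of preimages \<open>G a b\<close> of the four matrix units,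
  and of the all-one vector, which the degree map does not annihilate.\<close>
lemma ideal_dependent:
  assumes "r = 7" and x: "ideal x" and y: "ideal y" and z: "ideal z"
  shows "\<exists>p q s. (p \<noteq> 0 \<or> q \<noteq> 0 \<or> s \<noteq> 0) \<and> (\<forall>m. p * x m + q * y m + s * z m = 0)"
proof -
  define G where "G a b m = R (st m) b a / (of_real \<kappa> * D m)" for a b m
  have evG: "(\<Sum>m<r. G a b m * R m e f) = of_bool (e = a) * of_bool (f = b)"
    if "a < 2" "b < 2" "e < 2" "f < 2" for a b e f
  proof -
    have "(\<Sum>m<r. G a b m * R m e f) = (\<Sum>m<r. R m e f * R (st m) b a / D m) / of_real \<kappa>"
      by (simp add: G_def sum_divide_distrib mult_ac)
    thus ?thesis using that by (simp add: schur)
  qed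
  have degG: "(\<Sum>m<r. G a b m * D m) = 0" if "a < 2" "b < 2" for a b
  proof -
    have "(\<Sum>m<r. G a b m * D m) = (\<Sum>m<r. R (st m) b a) / of_real \<kappa>"
      unfolding sum_divide_distrib by (intro sum.cong refl) (simp add: G_def \<delta>_nonzero)
    thus ?thesis using that by (simp add: sum_R_star_eq_0)
  qed
  define w where "w i = [x, y, z, G 0 0, G 0 1, G 1 0, G 1 1, \<lambda>_. 1] ! i" for i
  obtain v where nz: "\<exists>i<Suc 7. v i \<noteq> 0" and v: "\<forall>m<7. (\<Sum>i<Suc 7. v i * w i m) = 0"
    using nontrivial_linear_relation[of 7 w] by blast
  have rel: "v 0 * x m + v 1 * y m + v 2 * z m + v 3 * G 0 0 m + v 4 * G 0 1 m + v 5 * G 1 0 m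
      + v 6 * G 1 1 m + v 7 = 0" if "m < r" for m
    using v that \<open>r = 7\<close> by (simp add: w_def eval_nat_numeral)
  have pair: "v 0 * (\<Sum>m<r. x m * g m) + v 1 * (\<Sum>m<r. y m * g m) + v 2 * (\<Sum>m<r. z m * g m)
      + v 3 * (\<Sum>m<r. G 0 0 m * g m) + v 4 * (\<Sum>m<r. G 0 1 m * g m) + v 5 * (\<Sum>m<r. G 1 0 m * g m)
      + v 6 * (\<Sum>m<r. G 1 1 m * g m) + v 7 * (\<Sum>m<r. g m) = 0" for g
  proof -
    have "0 = (\<Sum>m<r. (v 0 * x m + v 1 * y m + v 2 * z m + v 3 * G 0 0 m + v 4 * G 0 1 m + v 5 * G 1 0 m
      + v 6 * G 1 1 m + v 7) * g m)" by (intro sum.neutral[symmetric] ballI) (simp only: rel lessThan_iff mult_zero_left)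
    also have "\<dots> = v 0 * (\<Sum>m<r. x m * g m) + v 1 * (\<Sum>m<r. y m * g m) + v 2 * (\<Sum>m<r. z m * g m)
      + v 3 * (\<Sum>m<r. G 0 0 m * g m) + v 4 * (\<Sum>m<r. G 0 1 m * g m) + v 5 * (\<Sum>m<r. G 1 0 m * g m)
      + v 6 * (\<Sum>m<r. G 1 1 m * g m) + v 7 * (\<Sum>m<r. g m)"
      by (simp only: distrib_right sum.distrib mult.assoc flip: sum_distrib_left)
    finally show ?thesis by simp
  qed
  have zero: "(\<Sum>m<r. x m * R m a b) = 0" "(\<Sum>m<r. y m * R m a b) = 0" "(\<Sum>m<r. z m * R m a b) = 0"
    if "a < 2" "b < 2" for a b
    using x y z that by (auto simp: ideal_def ev_def)
  have deg: "(\<Sum>m<r. x m * D m) = 0" "(\<Sum>m<r. y m * D m) = 0" "(\<Sum>m<r. z m * D m) = 0"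
    using x y z by (auto simp: ideal_def)
  have "(\<Sum>m<r. D m) = of_real n" by (simp add: RBA_order_def)
  \<comment> \<open>Pairing with the degrees kills everything but the all-one vector; pairing with
    an entry of \<open>R\<close> kills everything but the preimage of one matrix unit.\<close>
  hence "v 7 = 0" using pair[of D] by (simp add: deg degG)
  moreover have "v 3 = 0" using pair[of "\<lambda>m. R m 0 0"] by (simp add: zero evG sum_R_eq_0)
  moreover have "v 4 = 0" using pair[of "\<lambda>m. R m 0 1"] by (simp add: zero evG sum_R_eq_0)
  moreover have "v 5 = 0" using pair[of "\<lambda>m. R m 1 0"] by (simp add: zero evG sum_R_eq_0)
  moreover have "v 6 = 0" using pair[of "\<lambda>m. R m 1 1"] by (simp add: zero evG sum_R_eq_0)
  ultimately have "v 0 \<noteq> 0 \<or> v 1 \<noteq> 0 \<or> v 2 \<noteq> 0" and "v 0 * x m + v 1 * y m + v 2 * z m = 0" if "m < r" for m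
    using nz rel[OF that] by (auto simp: less_Suc_eq eval_nat_numeral)
  moreover have "v 0 * x m + v 1 * y m + v 2 * z m = 0" if "\<not> m < r" for m
    using x y z that by (simp add: ideal_def alg_def)
  ultimately show ?thesis using r_pos by blast
qed

subsection \<open>The complementary ideal\<close>

text \<open>\<open>cotrace\<close> is \<open>\<tau>/n\<close> minus the contributions of \<open>\<chi>\<close> and of the degree map, and \<open>unit\<close>, its dual
  element, is the identity of \<open>ideal\<close>, the complement of the two corresponding blocks.\<close>
definition cotrace :: "nat \<Rightarrow> complex" where
  "cotrace i = of_bool (i = 0) - \<chi> i / of_real \<kappa> - D i / of_real n"

definition unit :: "nat \<Rightarrow> complex" where
  "unit m = (if m < r then cotrace (st m) / D m else 0)"

lemma alg_unit [simp]: "alg unit"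
  by (simp add: alg_def unit_def)

lemma cotrace_mult:
  assumes "i < r" "j < r"
  shows "(\<Sum>l<r. c i j l * cotrace l)
    = of_bool (j = st i) * D i - (\<Sum>a<2. \<Sum>b<2. R i a b * R j b a) / of_real \<kappa> - D i * D j / of_real n"
proof -
  have "(\<Sum>l<r. c i j l * cotrace l) = (\<Sum>l<r. c i j l * of_bool (l = 0))
      - (\<Sum>l<r. c i j l * \<chi> l) / of_real \<kappa> - (\<Sum>l<r. c i j l * D l) / of_real n"
    by (simp only: cotrace_def right_diff_distrib sum_subtractf sum_divide_distrib times_divide_eq_right)
  also have "(\<Sum>l<r. c i j l * of_bool (l = 0)) = of_bool (j = st i) * D i"
    using r_pos assms by (simp only: sum_of_bool_eq_left c_zero)
  also have "(\<Sum>l<r. c i j l * \<chi> l) = (\<Sum>a<2. \<Sum>l<r. c i j l * R l a a)"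
    by (simp add: \<chi>_eq sum_distrib_left) (rule sum.swap)
  also have "\<dots> = (\<Sum>a<2. \<Sum>b<2. R i a b * R j b a)"
    using assms by (simp add: R_mult)
  also have "(\<Sum>l<r. c i j l * D l) = D i * D j"
    using arg_cong[OF \<delta>_mult[OF assms], of complex_of_real] by simp
  finally show ?thesis .
qed

lemma cotrace_commute:
  assumes "i < r" "j < r"
  shows "(\<Sum>l<r. c i j l * cotrace l) = (\<Sum>l<r. c j i l * cotrace l)"
proof -
  have "j = st i \<longleftrightarrow> i = st j" using assms by (metis st_st)
  moreover have "D i = D j" if "j = st i" using assms that by simp
  ultimately show ?thesis
    using assms by (simp add: cotrace_mult sum_lessThan_two mult.commute add_ac)
qed

text \<open>Cyclic rotation turns both products into the value of \<open>cotrace\<close> at the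
  \<open>i\<close>-th basis element times the star of the \<open>m\<close>-th, divided by
  \<open>\<delta> m\<close>. Hence \<open>unit\<close> is central.\<close>

lemma mul_unit_basis:
  assumes "i < r" "m < r"
  shows "mul unit (basis i) m = (\<Sum>l<r. c i (st m) l * cotrace l) / D m"
    and "mul (basis i) unit m = (\<Sum>l<r. c i (st m) l * cotrace l) / D m"
proof -
  have "mul unit (basis i) m = (\<Sum>k<r. unit k * c k i m)"
    using assms by (simp add: mul_def basis_def sum_of_bool_eq_left)
  also have "\<dots> = (\<Sum>k<r. cotrace (st k) * (c k i m / D k))"
    by (simp add: unit_def)
  also have "\<dots> = (\<Sum>k<r. c i (st m) (st k) * cotrace (st k)) / D m"
    unfolding sum_divide_distrib using assms by (intro sum.cong refl) (simp add: c_rotate_left[of _ i])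
  also have "\<dots> = (\<Sum>l<r. c i (st m) l * cotrace l) / D m"
    by (simp only: sum_st[of "\<lambda>l. c i (st m) l * cotrace l"])
  finally show "mul unit (basis i) m = (\<Sum>l<r. c i (st m) l * cotrace l) / D m" .
  have "mul (basis i) unit m = (\<Sum>k<r. cotrace (st k) * (c i k m / D k))"
    using assms by (simp add: mul_basis unit_def)
  also have "\<dots> = (\<Sum>k<r. c (st m) i (st k) * cotrace (st k)) / D m"
    unfolding sum_divide_distrib using assms by (intro sum.cong refl) (simp add: c_rotate_right[of i])
  also have "\<dots> = (\<Sum>l<r. c (st m) i l * cotrace l) / D m"
    by (simp only: sum_st[of "\<lambda>l. c (st m) i l * cotrace l"])
  also have "\<dots> = (\<Sum>l<r. c i (st m) l * cotrace l) / D m"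
    using assms by (simp add: cotrace_commute)
  finally show "mul (basis i) unit m = (\<Sum>l<r. c i (st m) l * cotrace l) / D m" .
qed

lemma unit_central: "mul x unit = mul unit x"
proof (rule alg_eqI)
  fix m assume m: "m < r"
  have "mul unit x m = (\<Sum>i<r. unit i * (\<Sum>j<r. x j * c i j m))" using m by (simp add: mul_def)
  also have "\<dots> = (\<Sum>j<r. x j * (\<Sum>i<r. unit i * c i j m))"
    by (simp only: sum_distrib_left mult.left_commute) (rule sum.swap)
  also have "\<dots> = (\<Sum>j<r. x j * mul unit (basis j) m)"
    using m by (intro sum.cong refl) (simp add: mul_def[of unit] basis_def sum_of_bool_eq_left)
  also have "\<dots> = mul x unit m"
    using m by (simp add: mul_eq_sum_basis[of m x] mul_unit_basis)
  finally show "mul x unit m = mul unit x m" by simp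
qed simp_all

text \<open>On the common kernel the contributions of \<open>\<chi>\<close> and of the degree map to
  \<open>cotrace\<close> vanish, and the remaining term reproduces the coefficient of
  \<open>x\<close>.\<close>

lemma mul_unit_ideal:
  assumes "ideal x"
  shows "mul unit x = x"
proof (rule alg_eqI)
  fix m assume m: "m < r"
  have "mul unit x m = (\<Sum>i<r. x i * mul (basis i) unit m)"
    using m by (simp add: unit_central[symmetric] mul_eq_sum_basis[of m x])
  also have "\<dots> = (\<Sum>i<r. x i * (of_bool (st m = st i) * D i - (\<Sum>a<2. \<Sum>b<2. R i a b * R (st m) b a) / of_real \<kappa>
      - D i * D m / of_real n) / D m)"
    using m by (intro sum.cong refl) (simp add: mul_unit_basis cotrace_mult)
  also have "\<dots> = (\<Sum>i<r. of_bool (i = m) * x i) - (\<Sum>a<2. \<Sum>b<2. ev x a b * R (st m) b a) / (of_real \<kappa> * D m)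
      - (\<Sum>i<r. x i * D i) / of_real n"
  proof -
    have "x i * (of_bool (st m = st i) * D i - (\<Sum>a<2. \<Sum>b<2. R i a b * R (st m) b a) / of_real \<kappa>
        - D i * D m / of_real n) / D m
      = of_bool (i = m) * x i - (\<Sum>a<2. \<Sum>b<2. x i * R i a b * R (st m) b a) / (of_real \<kappa> * D m) - x i * D i / of_real n"
      if "i < r" for i
      using that m \<delta>_nonzero[OF m] by (auto simp: st_eq_iff sum_lessThan_two field_simps)
    moreover have "(\<Sum>i<r. \<Sum>a<2. \<Sum>b<2. x i * R i a b * R (st m) b a) = (\<Sum>a<2. \<Sum>b<2. ev x a b * R (st m) b a)"
      by (simp add: ev_def sum_lessThan_two sum.distrib sum_distrib_right)
    ultimately show ?thesis
      by (simp add: sum_subtractf flip: sum_divide_distrib)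
  qed
  also have "\<dots> = x m"
    using assms m by (simp add: ideal_def sum_of_bool_eq_left)
  finally show "mul unit x m = x m" .
qed (use assms in \<open>simp_all add: ideal_def\<close>)

text \<open>Under \<open>R\<close> the identity cancels against the \<open>\<chi>\<close> term by
  the Schur relation; under the degree map the \<open>\<chi>\<close> term vanishes and 1 cancels
  against \<open>n / n\<close>.\<close>

lemma ideal_unit: "ideal unit"
proof -
  have unit_eq: "unit m = of_bool (m = 0) - \<chi> (st m) / (of_real \<kappa> * D m) - 1 / of_real n" if "m < r" for m
  proof -
    have "st m = 0 \<longleftrightarrow> m = 0" using that r_pos by (metis st_0 st_st)
    thus ?thesis using that \<delta>_nonzero[OF that] by (auto simp: unit_def cotrace_def field_simps)
  qed
  have pair: "(\<Sum>m<r. unit m * g m) = g 0 - (\<Sum>e<2. \<Sum>m<r. g m * R (st m) e e / D m) / of_real \<kappa> - (\<Sum>m<r. g m) / of_real n" for g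
  proof -
    have "(\<Sum>m<r. unit m * g m) = (\<Sum>m<r. of_bool (m = 0) * g m
        - (\<Sum>e<2. g m * R (st m) e e / D m) / of_real \<kappa> - g m / of_real n)"
      by (intro sum.cong refl) (simp add: unit_eq \<chi>_eq sum_lessThan_two \<delta>_nonzero field_simps)
    also have "\<dots> = g 0 - (\<Sum>m<r. \<Sum>e<2. g m * R (st m) e e / D m) / of_real \<kappa> - (\<Sum>m<r. g m) / of_real n"
      using r_pos by (simp only: sum_subtractf sum_of_bool_eq_left sum_divide_distrib)
    finally show ?thesis by (simp only: sum.swap[of _ "{..<2}"])
  qed
  have "ev unit a b = 0" if "a < 2" "b < 2" for a b
  proof -
    have "a = 0 \<or> a = Suc 0" "b = 0 \<or> b = Suc 0" using that by auto
    thus ?thesis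
      unfolding ev_def pair by (elim disjE) (simp_all add: schur R_one sum_R_eq_0 sum_lessThan_two)
  qed
  moreover have "(\<Sum>m<r. unit m * D m) = 0"
  proof -
    have "(\<Sum>m<r. D m * R (st m) e e / D m) = 0" if "e < 2" for e
    proof -
      have "(\<Sum>m<r. D m * R (st m) e e / D m) = (\<Sum>m<r. R (st m) e e)"
        by (intro sum.cong refl) (simp add: \<delta>_nonzero)
      thus ?thesis using that by (simp add: sum_R_star_eq_0)
    qed
    moreover have "(\<Sum>m<r. D m) = of_real n" by (simp add: RBA_order_def)
    ultimately show ?thesis unfolding pair by simp
  qed
  ultimately show ?thesis by (simp add: ideal_def)
qed

lemma star_unit: "star unit = unit"
proof (rule alg_eqI)
  fix m assume m: "m < r"
  have "st m = 0 \<longleftrightarrow> m = 0" using m r_pos by (metis st_0 st_st)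
  thus "star unit m = unit m"
    using m by (simp add: star_def unit_def cotrace_def Irr_star[OF \<chi>_Irr])
qed simp_all

lemma cotrace_eq: "i < r \<Longrightarrow> cotrace i = mul (basis i) unit 0"
proof -
  assume i: "i < r"
  have "c i 0 l = of_bool (l = i)" if "l < r" for l
    using lam_one(2)[OF i that] by auto
  thus ?thesis using i r_pos by (simp add: mul_unit_basis sum_of_bool_eq_left)
qed

text \<open>If \<open>unit\<close> is a common eigenvector or zero, \<open>cotrace\<close> is a
  multiple of one linear character or zero. Otherwise \<open>unit\<close> and some \<open>y\<close>
  span the ideal, \<open>y\<close> satisfies a quadratic equation with distinct roots, and
  \<open>unit\<close> splits into two common eigenvectors.\<close>

lemma cotrace_in_span:
  assumes r7: "r = 7"
  shows "Irr_span cotrace"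
proof (cases "\<exists>\<phi>. \<forall>i<r. mul (basis i) unit = (\<lambda>m. \<phi> i * unit m)")
  case True
  then obtain \<phi> where \<phi>: "\<And>i. i < r \<Longrightarrow> mul (basis i) unit = (\<lambda>m. \<phi> i * unit m)" by blast
  show ?thesis
  proof (cases "unit = (\<lambda>_. 0)")
    case True
    show ?thesis by (rule Irr_span_zero) (simp add: cotrace_eq True mul_zero_right)
  next
    case False
    show ?thesis
      by (rule Irr_span_scale_character[OF eigenvector_character_in_Irr[OF alg_unit False \<phi>], where z = "unit 0"])
         (simp_all add: cotrace_eq \<phi>)
  qed
next
  case False
  have "\<exists>j<r. \<forall>z. mul (basis j) unit \<noteq> (\<lambda>m. z * unit m)"
  proof (rule ccontr)
    assume "\<not> ?thesis"
    hence "\<forall>i\<in>{..<r}. \<exists>z. mul (basis i) unit = (\<lambda>m. z * unit m)" by auto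
    from bchoice[OF this] False show False by auto
  qed
  then obtain j where j: "j < r" and not_multiple: "\<And>z. mul (basis j) unit \<noteq> (\<lambda>m. z * unit m)" by blast
  define y where "y = mul (basis j) unit"
  have ideal_y: "ideal y" unfolding y_def by (rule ideal_mul_basis[OF ideal_unit j])
  hence alg_y: "alg y" by (simp add: ideal_def)
  have indep: "p = 0 \<and> q = 0" if pq: "\<And>m. p * y m + q * unit m = 0" for p q
  proof -
    have "p = 0"
    proof (rule ccontr)
      assume "p \<noteq> 0"
      hence "y m = (- q / p) * unit m" for m using pq[of m] by (simp add: field_simps eq_neg_iff_add_eq_0)
      hence "y = (\<lambda>m. (- q / p) * unit m)" by (rule ext)
      thus False using not_multiple unfolding y_def by blast
    qed
    moreover have "unit \<noteq> (\<lambda>_. 0)"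
      using not_multiple[of 0] by (auto simp: mul_zero_right)
    then obtain m where "unit m \<noteq> 0" by auto
    ultimately show ?thesis using pq[of m] by simp
  qed
  \<comment> \<open>Any three elements of the ideal are dependent, while \<open>y\<close> and
    \<open>unit\<close> are independent.\<close>
  have "\<exists>a b. mul (basis i) unit = (\<lambda>m. a * y m + b * unit m)" if i: "i < r" for i
  proof -
    obtain p q s where nz: "p \<noteq> 0 \<or> q \<noteq> 0 \<or> s \<noteq> 0"
      and rel: "\<And>m. p * y m + q * unit m + s * mul (basis i) unit m = 0"
      using ideal_dependent[OF r7 ideal_y ideal_unit ideal_mul_basis[OF ideal_unit i]] by blast
    have "s \<noteq> 0" using indep[of p q] rel nz by auto
    hence "mul (basis i) unit m = (- p / s) * y m + (- q / s) * unit m" for m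
      using rel[of m] by (simp add: field_simps eq_neg_iff_add_eq_0)
    thus ?thesis by blast
  qed
  then obtain \<alpha> \<beta> where comb: "\<And>i. i < r \<Longrightarrow> mul (basis i) unit = (\<lambda>m. \<alpha> i * y m + \<beta> i * unit m)"
    by metis
  have mul_ideal_comb: "\<exists>a b. mul x unit = (\<lambda>m. a * y m + b * unit m)" for x
  proof (intro exI)
    show "mul x unit = (\<lambda>m. (\<Sum>i<r. x i * \<alpha> i) * y m + (\<Sum>i<r. x i * \<beta> i) * unit m)"
    proof (rule alg_eqI)
      fix m assume m: "m < r"
      show "mul x unit m = (\<Sum>i<r. x i * \<alpha> i) * y m + (\<Sum>i<r. x i * \<beta> i) * unit m"
        using m by (simp add: mul_eq_sum_basis[of m x] comb distrib_left sum.distrib sum_distrib_right mult.assoc)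
    qed (simp_all add: alg_y)
  qed
  obtain A B where yy: "mul y y = (\<lambda>m. A * y m + B * unit m)"
  proof -
    have "mul y y = mul (mul (basis j) y) unit"
      using unit_central[of "mul (basis j) y"] mul_unit_ideal[OF ideal_mul_basis[OF ideal_y j]]
        mul_unit_ideal[OF ideal_y] by (simp add: y_def mul_assoc)
    thus ?thesis using mul_ideal_comb that by metis
  qed
  \<comment> \<open>\<open>r1\<close> and \<open>r2\<close> are the roots of
    \<open>X\<^sup>2 - A * X - B\<close>, which annihilates \<open>y\<close>.\<close>
  obtain r1 where r1: "(A - r1) * (0 - r1) = B * 1" using complex_eigenvalue_2 by blast
  define r2 where "r2 = A - r1"
  have B: "B = - (r1 * r2)" using r1 by (simp add: r2_def algebra_simps)
  have unit_y: "mul unit y = y" "mul y unit = y" "mul unit unit = unit"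
    by (simp_all only: unit_central[of y] mul_unit_ideal ideal_y ideal_unit)
  define v where "v s = (\<lambda>m. 1 * y m + (- s) * unit m)" for s
  have ideal_v: "ideal (v s)" for s
    unfolding v_def by (intro ideal_combination ideal_y ideal_unit)
  hence alg_v: "alg (v s)" for s by (simp add: ideal_def)
  have v_nonzero: "v s \<noteq> (\<lambda>_. 0)" for s
    using indep[of 1 "- s"] by (auto simp: v_def fun_eq_iff)
  \<comment> \<open>For a root \<open>s\<close> the other root is \<open>A - s\<close>, so
    \<open>y - (A - s) * unit\<close> is an eigenvector of \<open>y\<close> for
    \<open>s\<close>.\<close>
  have y_v: "mul y (v (A - s)) = (\<lambda>m. s * v (A - s) m)" if "B = - (s * (A - s))" for s
    unfolding v_def mul_combination_right yy unit_y by (auto simp: that algebra_simps)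
  have basis_v: "mul (basis i) (v (A - s)) = (\<lambda>m. (\<alpha> i * s + \<beta> i) * v (A - s) m)"
    if "i < r" "B = - (s * (A - s))" for i s
  proof -
    have "mul (basis i) (v (A - s)) = mul (mul (basis i) unit) (v (A - s))"
      by (simp add: mul_assoc mul_unit_ideal[OF ideal_v])
    also have "\<dots> = (\<lambda>m. \<alpha> i * (s * v (A - s) m) + \<beta> i * v (A - s) m)"
      by (simp only: comb[OF that(1)] mul_combination_left y_v[OF that(2)] mul_unit_ideal[OF ideal_v])
    finally show ?thesis by (simp add: algebra_simps)
  qed
  have B2: "B = - (r2 * (A - r2))" "B = - (r1 * (A - r1))" by (simp_all add: B r2_def)
  \<comment> \<open>With a double root, \<open>z = y - r1 * unit\<close> has square zero. Its star
    lies in the span of \<open>y\<close> and \<open>unit\<close>, so \<open>z\<close> is normal and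
    must vanish.\<close>
  have "r1 \<noteq> r2"
  proof
    assume "r1 = r2"
    hence eq: "A - r1 = r1" by (simp add: r2_def)
    define z where "z = v r1"
    have z: "ideal z" "alg z" "z \<noteq> (\<lambda>_. 0)" by (simp_all add: z_def ideal_v alg_v v_nonzero)
    have yz: "mul y z = (\<lambda>m. r1 * z m)" using y_v[OF B2(2), unfolded eq] by (simp only: z_def)
    have uz: "mul unit z = z" by (rule mul_unit_ideal[OF z(1)])
    have zy: "mul z y = mul y z"
      unfolding z_def v_def mul_combination_left mul_combination_right unit_y ..
    have "mul z z = (\<lambda>m. 1 * mul y z m + (- r1) * mul unit z m)"
      by (subst (1) z_def) (simp only: v_def mul_combination_left)
    hence zz: "mul z z = (\<lambda>_. 0)" by (simp add: yz uz)
    have "star z = mul (star z) unit"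
      using star_mul[of unit z] by (simp add: uz star_unit)
    then obtain a b where sz: "star z = (\<lambda>m. a * y m + b * unit m)"
      using mul_ideal_comb[of "star z"] by auto
    have "mul z (star z) = mul (star z) z"
      unfolding sz mul_combination_left mul_combination_right zy unit_central[of z] ..
    with z zz show False using normal_nilpotent_zero by blast
  qed
  define \<phi> where "\<phi> s i = (if i < r then \<alpha> i * s + \<beta> i else 0)" for s i
  have \<phi>_Irr: "\<phi> r1 \<in> Irr r lam" "\<phi> r2 \<in> Irr r lam"
    using eigenvector_character_in_Irr[OF alg_v v_nonzero basis_v[OF _ B2(2)]]
      eigenvector_character_in_Irr[OF alg_v v_nonzero basis_v[OF _ B2(1)]]
    by (simp_all add: \<phi>_def[abs_def])
  have "cotrace i = (v r2 0 / (r1 - r2)) * \<phi> r1 i + (- v r1 0 / (r1 - r2)) * \<phi> r2 i" if i: "i < r" for i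
  proof -
    have "unit = (\<lambda>m. (1 / (r1 - r2)) * v r2 m + (- 1 / (r1 - r2)) * v r1 m)"
      using \<open>r1 \<noteq> r2\<close> by (intro ext) (simp add: v_def divide_simps, simp add: algebra_simps)
    hence "mul (basis i) unit = (\<lambda>m. (1 / (r1 - r2)) * mul (basis i) (v r2) m + (- 1 / (r1 - r2)) * mul (basis i) (v r1) m)"
      using mul_combination_right[of "basis i" "1 / (r1 - r2)" "v r2" "- 1 / (r1 - r2)" "v r1"] by metis
    moreover have "A - r1 = r2" "A - r2 = r1" by (simp_all add: r2_def)
    ultimately show ?thesis
      using basis_v[OF i B2(1)] basis_v[OF i B2(2)] i by (simp add: cotrace_eq \<phi>_def mult.commute)
  qed
  thus ?thesis
    by (rule Irr_span_add[OF Irr_span_scale_character[OF \<phi>_Irr(1) refl] Irr_span_scale_character[OF \<phi>_Irr(2) refl]])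
qed

lemma std_trace_in_span:
  assumes "r = 7"
  shows "Irr_span (std_trace r \<delta>)"
proof -
  have "Irr_span (\<lambda>i. of_real n * cotrace i)"
    using cotrace_in_span[OF assms] unfolding Irr_span_def
  proof (elim exE conjE)
    fix F z assume F: "finite F" "F \<subseteq> Irr r lam" "\<forall>i<r. cotrace i = (\<Sum>\<psi>\<in>F. z \<psi> * \<psi> i)"
    thus "\<exists>F z. finite F \<and> F \<subseteq> Irr r lam \<and> (\<forall>i<r. of_real n * cotrace i = (\<Sum>\<psi>\<in>F. z \<psi> * \<psi> i))"
      by (intro exI[of _ F] exI[of _ "\<lambda>\<psi>. of_real n * z \<psi>"]) (simp add: sum_distrib_left mult.assoc)
  qed
  moreover have "Irr_span (\<lambda>i. of_real (n / \<kappa>) * \<chi> i)"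
    by (rule Irr_span_scale_character[OF \<chi>_Irr refl])
  ultimately have "Irr_span (\<lambda>i. of_real n * cotrace i + of_real (n / \<kappa>) * \<chi> i)"
    by (rule Irr_span_add) simp
  moreover have "Irr_span D"
    by (rule Irr_span_scale_character[OF degree_map_in_Irr, where z = 1]) simp
  ultimately show ?thesis
    by (rule Irr_span_add) (simp add: std_trace_def cotrace_def algebra_simps)
qed

lemma multiplicity_\<chi>:
  assumes "r = 7" and "\<kappa> = sqnorm \<chi> / 2"
  shows "multiplicity r lam \<delta> \<chi> = n / \<kappa>"
  using multiplicity_eq[OF std_trace_in_span[OF assms(1)] \<chi>_Irr] unfolding assms(2) by (simp add: \<chi>_0)

subsection \<open>Frobenius--Schur indicator minus one\<close>

lemma sum_c_\<chi>:
  assumes "i < r" "j < r"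
  shows "(\<Sum>k<r. c i j k * \<chi> k) = (\<Sum>a<2. \<Sum>b<2. R i a b * R j b a)"
proof -
  have "(\<Sum>k<r. c i j k * \<chi> k) = (\<Sum>a<2. \<Sum>k<r. c i j k * R k a a)"
    by (simp add: \<chi>_eq sum_distrib_left) (rule sum.swap)
  thus ?thesis using assms by (simp add: R_mult)
qed

text \<open>For a \<open>2 \<times> 2\<close> matrix \<open>X\<close> and \<open>\<epsilon> = (0 1; -1 0)\<close> we have \<open>X \<epsilon> X\<^sup>T = det X \<epsilon>\<close>, so the average
  \<open>\<Sum>\<^sub>i R\<^sub>i \<epsilon> R\<^sub>i\<^sup>T/\<delta>\<^sub>i\<close> is \<open>\<epsilon>\<close> up to the factor \<open>\<Sum>\<^sub>i det R\<^sub>i/\<delta>\<^sub>i\<close>. If that is nonzero, then \<open>\<epsilon>\<close>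
  intertwines \<open>R\<close> with its dual, that is, \<open>R\<^sub>i\<^sub>*\<close> is the adjugate of \<open>R\<^sub>i\<close>.\<close>
lemma R_star_adjugate:
  assumes det: "(\<Sum>i<r. (R i 0 0 * R i 1 1 - R i 0 1 * R i 1 0) / D i) \<noteq> 0" and j: "j < r"
  shows "R (st j) 0 0 = R j 1 1" "R (st j) 1 1 = R j 0 0" "R (st j) 0 1 = - R j 0 1" "R (st j) 1 0 = - R j 1 0"
proof -
  \<comment> \<open>The dual representation: transposition and the star each reverse
    products.\<close>
  define Q where "Q i a b = R (st i) b a" for i a b
  have Q: "rep 2 Q"
    unfolding rep_def
  proof (intro conjI allI impI)
    fix i j a b assume ij: "i < r" "j < r" and ab: "a < (2 :: nat)" "b < (2 :: nat)"
    have "(\<Sum>e<2. Q i a e * Q j e b) = (\<Sum>e<2. R (st j) b e * R (st i) e a)"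
      by (simp add: Q_def mult.commute)
    also have "\<dots> = (\<Sum>k<r. c (st j) (st i) k * R k b a)" using ij ab by (simp add: R_mult)
    also have "\<dots> = (\<Sum>k<r. c (st j) (st i) (st k) * R (st k) b a)"
      by (simp only: sum_st[of "\<lambda>k. c (st j) (st i) k * R k b a"])
    also have "\<dots> = (\<Sum>k<r. c i j k * Q k a b)"
      using ij by (intro sum.cong refl) (simp add: lam_star Q_def)
    finally show "(\<Sum>e<2. Q i a e * Q j e b) = (\<Sum>k<r. c i j k * Q k a b)" .
  qed (simp add: Q_def R_one)
  define S where "S b f a x = (\<Sum>i<r. R i a b * R i x f / D i)" for a b x f
  \<comment> \<open>This is the average of \<open>R i\<close> times the alternating matrix times the
    transpose of \<open>R i\<close>.\<close>
  define T where "T a x = S 0 1 a x - S 1 0 a x" for a x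
  have intS: "(\<Sum>a'<2. R j a a' * S b f a' x) = (\<Sum>x'<2. S b f a x' * Q j x' x)"
    if "a < 2" "x < 2" "b < 2" "f < 2" for a x b f
  proof -
    have "S b f a x = (\<Sum>i<r. R i a b * Q (st i) f x / D i)" for a b f x
      unfolding S_def by (intro sum.cong refl) (simp add: Q_def)
    thus ?thesis using that j irr_rep[OF irr_R] Q by (simp only:) (rule average_intertwines)
  qed
  have int: "(\<Sum>b<2. R j a b * T b x) = (\<Sum>e<2. T a e * Q j e x)" if "a < 2" "x < 2" for a x
    using that by (simp only: T_def right_diff_distrib left_diff_distrib sum_subtractf) (simp add: intS)
  define \<Delta> where "\<Delta> = (\<Sum>i<r. (R i 0 0 * R i 1 1 - R i 0 1 * R i 1 0) / D i)"
  have T: "T 0 0 = 0" "T 1 1 = 0" "T 0 1 = \<Delta>" "T 1 0 = - \<Delta>"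
    by (simp_all add: T_def S_def \<Delta>_def diff_divide_distrib sum_subtractf mult.commute)
  have "\<Delta> \<noteq> 0" using det by (simp add: \<Delta>_def)
  moreover have "\<Delta> * R (st j) 0 1 = \<Delta> * - R j 0 1" "\<Delta> * R (st j) 1 1 = \<Delta> * R j 0 0"
    "\<Delta> * R (st j) 0 0 = \<Delta> * R j 1 1" "\<Delta> * R (st j) 1 0 = \<Delta> * - R j 1 0"
    using int[of 0 0] int[of 0 1] int[of 1 0] int[of 1 1]
    by (auto simp: T[unfolded One_nat_def] sum_lessThan_two Q_def mult.commute)
  ultimately show "R (st j) 0 0 = R j 1 1" "R (st j) 1 1 = R j 0 0" "R (st j) 0 1 = - R j 0 1" "R (st j) 1 0 = - R j 1 0"
    by (simp_all only: mult_cancel_left) simp_all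
qed

text \<open>Adding \<open>sqnorm \<chi>\<close> to the real part of the sum gives the sum of
  \<open>2 * (Re (\<chi> i))\<^sup>2 / \<delta> i\<close>, which is positive because of
  \<open>i = 0\<close>.\<close>

lemma square_norm_sum_nonzero: "(\<Sum>i<r. (\<chi> i)\<^sup>2 / D i) \<noteq> - of_real (sqnorm \<chi>)"
proof
  assume "(\<Sum>i<r. (\<chi> i)\<^sup>2 / D i) = - of_real (sqnorm \<chi>)"
  hence "Re (\<Sum>i<r. (\<chi> i)\<^sup>2 / D i) = - sqnorm \<chi>" by simp
  moreover have "Re (\<Sum>i<r. (\<chi> i)\<^sup>2 / D i) = (\<Sum>i<r. ((Re (\<chi> i))\<^sup>2 - (Im (\<chi> i))\<^sup>2) / \<delta> i)"
    by (simp add: Re_divide_of_real power2_eq_square)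
  moreover have "sqnorm \<chi> = (\<Sum>i<r. ((Re (\<chi> i))\<^sup>2 + (Im (\<chi> i))\<^sup>2) / \<delta> i)"
    by (simp add: sqnorm_def cmod_power2)
  ultimately have "(\<Sum>i<r. ((Re (\<chi> i))\<^sup>2 - (Im (\<chi> i))\<^sup>2) / \<delta> i + ((Re (\<chi> i))\<^sup>2 + (Im (\<chi> i))\<^sup>2) / \<delta> i) = 0"
    unfolding sum.distrib by linarith
  hence "(\<Sum>i<r. 2 * (Re (\<chi> i))\<^sup>2 / \<delta> i) = 0"
    by (simp flip: add_divide_distrib)
  moreover have "2 * (Re (\<chi> 0))\<^sup>2 / \<delta> 0 \<le> (\<Sum>i<r. 2 * (Re (\<chi> i))\<^sup>2 / \<delta> i)"
    using r_pos \<delta>_pos by (intro member_le_sum) (auto simp: less_imp_le)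
  ultimately show False by (simp add: \<chi>_0)
qed

text \<open>\<open>G l k = \<chi>(b\<^sub>l b\<^sub>k\<^sup>*)\<close>; dividing by \<open>\<kappa> \<delta>\<^sub>k\<close> gives the matrix of the projection onto the block of \<open>\<chi>\<close>.\<close>
definition G :: "nat \<Rightarrow> nat \<Rightarrow> complex" where
  "G l k = (\<Sum>a<2. \<Sum>b<2. R l a b * R (st k) b a)"

lemma G_convolution:
  assumes "l < r" "m < r"
  shows "(\<Sum>k<r. G l k * G k m / D k) = of_real \<kappa> * G l m"
proof -
  have "G l k * G k m / D k
      = (\<Sum>a<2. \<Sum>b<2. \<Sum>e<2. \<Sum>f<2. R l a b * R (st m) f e * (R k e f * R (st k) b a / D k))" for k
    by (simp add: G_def sum_lessThan_two algebra_simps add_divide_distrib)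
  hence "(\<Sum>k<r. G l k * G k m / D k)
      = (\<Sum>a<2. \<Sum>b<2. \<Sum>e<2. \<Sum>f<2. R l a b * R (st m) f e * (\<Sum>k<r. R k e f * R (st k) b a / D k))"
    by (simp only: sum_lessThan_two sum.distrib sum_distrib_left)
  also have "\<dots> = of_real \<kappa> * G l m"
    by (simp add: schur sum_lessThan_two G_def algebra_simps)
  finally show ?thesis .
qed

text \<open>The projection has trace 4, the dimension of the block.\<close>

lemma G_trace: "(\<Sum>l<r. G l l / D l) = 4 * of_real \<kappa>"
proof -
  have "(\<Sum>l<r. G l l / D l) = (\<Sum>a<2. \<Sum>b<2. \<Sum>l<r. R l a b * R (st l) b a / D l)"
    by (simp only: G_def sum_lessThan_two add_divide_distrib sum.distrib)
  thus ?thesis by (simp add: schur sum_lessThan_two)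
qed

lemma G_eq: "l < r \<Longrightarrow> k < r \<Longrightarrow> G l k = (\<Sum>m<r. c l (st k) m * \<chi> m)"
  by (simp add: G_def sum_c_\<chi>)

end

section \<open>The quaternionic case in rank 7\<close>

locale rba_quaternionic = rba_two +
  assumes r7: "r = 7" and \<kappa>_sqnorm: "\<kappa> = sqnorm \<chi> / 2"
    and indicator: "(\<Sum>i<r. (\<Sum>k<r. c i i k * \<chi> k) / D i) = - 2 * of_real \<kappa>"
begin

text \<open>For a 2 by 2 matrix, the square of the trace minus the trace of the square is twice the
  determinant. The indicator therefore turns the averaged determinants into the sum treated by
  \<open>square_norm_sum_nonzero\<close>.\<close>

lemma R_star:
  assumes "j < r"
  shows "R (st j) 0 0 = R j 1 1" "R (st j) 1 1 = R j 0 0" "R (st j) 0 1 = - R j 0 1" "R (st j) 1 0 = - R j 1 0"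
proof -
  have "(\<chi> i)\<^sup>2 - (\<Sum>k<r. c i i k * \<chi> k) = 2 * (R i 0 0 * R i 1 1 - R i 0 1 * R i 1 0)" if "i < r" for i
    using that by (simp add: sum_c_\<chi>) (simp add: \<chi>_eq sum_lessThan_two power2_eq_square algebra_simps)
  hence "2 * (\<Sum>i<r. (R i 0 0 * R i 1 1 - R i 0 1 * R i 1 0) / D i)
      = (\<Sum>i<r. (\<chi> i)\<^sup>2 / D i - (\<Sum>k<r. c i i k * \<chi> k) / D i)"
    unfolding sum_distrib_left by (intro sum.cong refl) (simp flip: diff_divide_distrib)
  also have "\<dots> = (\<Sum>i<r. (\<chi> i)\<^sup>2 / D i) + of_real (sqnorm \<chi>)"
    by (simp add: sum_subtractf indicator \<kappa>_sqnorm)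
  also have "\<dots> \<noteq> 0" using square_norm_sum_nonzero by (simp add: add_eq_0_iff2)
  finally have "(\<Sum>i<r. (R i 0 0 * R i 1 1 - R i 0 1 * R i 1 0) / D i) \<noteq> 0" by auto
  from R_star_adjugate[OF this assms]
  show "R (st j) 0 0 = R j 1 1" "R (st j) 1 1 = R j 0 0" "R (st j) 0 1 = - R j 0 1" "R (st j) 1 0 = - R j 1 0" .
qed

definition t :: "nat \<Rightarrow> real" where
  "t i = Re (\<chi> i)"

lemma \<chi>_star: "i < r \<Longrightarrow> \<chi> (st i) = \<chi> i"
  using R_star[of i] by (simp add: \<chi>_eq sum_lessThan_two add.commute)

lemma \<chi>_real: "i < r \<Longrightarrow> \<chi> i = of_real (t i)"
  using \<chi>_star[of i] Irr_star[OF \<chi>_Irr, of i] by (simp add: t_def complex_eq_iff)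

lemma t_star: "i < r \<Longrightarrow> t (st i) = t i"
  by (simp add: t_def \<chi>_star)

text \<open>The real form of \<open>G\<close>, available since the values of \<open>\<chi>\<close>
  are real.\<close>

definition g :: "nat \<Rightarrow> nat \<Rightarrow> real" where
  "g l k = (\<Sum>m<r. lam l (st k) m * t m)"

lemma G_g: "l < r \<Longrightarrow> k < r \<Longrightarrow> G l k = of_real (g l k)"
  by (simp add: G_eq g_def \<chi>_real)

lemma g_commute:
  assumes "l < r" "k < r"
  shows "g l k = g k l"
proof -
  have "G l k = G k l"
    using R_star[OF assms(1)] R_star[OF assms(2)] by (simp add: G_def sum_lessThan_two algebra_simps)
  thus ?thesis using assms by (simp add: G_g)
qed

lemma g_convolution:
  assumes "l < r" "m < r"
  shows "(\<Sum>k<r. g l k * g m k / \<delta> k) = \<kappa> * g l m"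
proof -
  have "complex_of_real (\<Sum>k<r. g l k * g m k / \<delta> k) = (\<Sum>k<r. G l k * G k m / D k)"
    unfolding of_real_sum using assms by (intro sum.cong refl) (simp add: G_g g_commute[of m])
  also have "\<dots> = of_real \<kappa> * G l m" using assms by (rule G_convolution)
  also have "\<dots> = of_real (\<kappa> * g l m)" using assms by (simp add: G_g)
  finally show ?thesis by (simp only: of_real_eq_iff)
qed

lemma g_trace: "(\<Sum>l<r. g l l / \<delta> l) = 4 * \<kappa>"
proof -
  have "complex_of_real (\<Sum>l<r. g l l / \<delta> l) = of_real (4 * \<kappa>)"
    using G_trace by (simp add: G_g)
  thus ?thesis by (simp only: of_real_eq_iff)
qed

text \<open>Here \<open>g l (st l)\<close> is the value of \<open>\<chi>\<close> at the square of
  the \<open>l\<close>-th basis element, so the sum is the one in the indicator.\<close>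

lemma g_star_trace: "(\<Sum>l<r. g l (st l) / \<delta> l) = - 2 * \<kappa>"
proof -
  have "complex_of_real (g l (st l) / \<delta> l) = (\<Sum>k<r. c l l k * \<chi> k) / D l" if "l < r" for l
    using that G_eq[of l "st l"] G_g[of l "st l"] by simp
  hence "complex_of_real (\<Sum>l<r. g l (st l) / \<delta> l) = (\<Sum>l<r. (\<Sum>k<r. c l l k * \<chi> k) / D l)"
    unfolding of_real_sum by (intro sum.cong refl) simp
  also have "\<dots> = of_real (- 2 * \<kappa>)" unfolding indicator by simp
  finally have "complex_of_real (\<Sum>l<r. g l (st l) / \<delta> l) = of_real (- 2 * \<kappa>)" .
  thus ?thesis by (simp only: of_real_eq_iff)
qed

text \<open>\<open>h l k / (\<kappa> * \<delta> k)\<close> is the \<open>k\<close>-th coordinate of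
  the projection to the block of the \<open>l\<close>-th basis element minus its star;
  \<open>e l k\<close> is that of the difference itself.\<close>

definition h :: "nat \<Rightarrow> nat \<Rightarrow> real" where
  "h l k = g l k - g (st l) k"

definition e :: "nat \<Rightarrow> nat \<Rightarrow> real" where
  "e l k = of_bool (k = l) - of_bool (k = st l)"

text \<open>Expand the square. As the projection is orthogonal, the projected vector has the same
  inner product with itself as with the original, so the defect is the difference of the two squared
  norms.\<close>

lemma projection_defect:
  assumes "l < r"
  shows "(\<Sum>k<r. (h l k / (\<kappa> * \<delta> k) - e l k)\<^sup>2 * \<delta> k / \<delta> l)
    = 2 * of_bool (st l \<noteq> l) - (g l l / \<delta> l - 2 * (g l (st l) / \<delta> l) + g (st l) (st l) / \<delta> l) / \<kappa>"
proof -
  define q where "q = g l l - 2 * g l (st l) + g (st l) (st l)"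
  have sl: "st l < r" using assms by simp
  have "(\<Sum>k<r. (h l k)\<^sup>2 / \<delta> k) = (\<Sum>k<r. g l k * g l k / \<delta> k) - 2 * (\<Sum>k<r. g l k * g (st l) k / \<delta> k)
      + (\<Sum>k<r. g (st l) k * g (st l) k / \<delta> k)"
    unfolding sum_distrib_left sum_subtractf[symmetric] sum.distrib[symmetric]
    by (intro sum.cong refl) (simp add: h_def power2_eq_square diff_divide_distrib add_divide_distrib algebra_simps)
  also have "\<dots> = \<kappa> * q" using assms sl by (simp add: g_convolution q_def algebra_simps)
  finally have hh: "(\<Sum>k<r. (h l k)\<^sup>2 / \<delta> k) = \<kappa> * q" .
  have "(\<Sum>k<r. h l k * e l k) = h l l - h l (st l)"
    using assms sl by (simp only: e_def right_diff_distrib sum_subtractf sum_of_bool_eq_left)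
  also have "\<dots> = q" using assms sl by (simp add: h_def q_def g_commute[of "st l" l])
  finally have he: "(\<Sum>k<r. h l k * e l k) = q" .
  have "(e l k)\<^sup>2 * \<delta> k = of_bool (st l \<noteq> l) * (of_bool (k = l) * \<delta> k + of_bool (k = st l) * \<delta> k)" for k
    by (auto simp: e_def)
  hence "(\<Sum>k<r. (e l k)\<^sup>2 * \<delta> k) = of_bool (st l \<noteq> l) * (\<delta> l + \<delta> (st l))"
    using assms sl by (simp only: sum.distrib sum_of_bool_eq_left flip: sum_distrib_left)
  hence ee: "(\<Sum>k<r. (e l k)\<^sup>2 * \<delta> k) = 2 * of_bool (st l \<noteq> l) * \<delta> l" using assms by simp
  have "(h l k / (\<kappa> * \<delta> k) - e l k)\<^sup>2 * \<delta> k / \<delta> l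
      = ((h l k)\<^sup>2 / \<delta> k / \<kappa>\<^sup>2 - 2 * (h l k * e l k) / \<kappa> + (e l k)\<^sup>2 * \<delta> k) / \<delta> l" if "k < r" for k
    using \<delta>_nonzero[OF that] \<delta>_nonzero[OF assms] by (simp add: field_simps power2_eq_square)
  hence "(\<Sum>k<r. (h l k / (\<kappa> * \<delta> k) - e l k)\<^sup>2 * \<delta> k / \<delta> l)
      = ((\<Sum>k<r. (h l k)\<^sup>2 / \<delta> k) / \<kappa>\<^sup>2 - 2 * (\<Sum>k<r. h l k * e l k) / \<kappa> + (\<Sum>k<r. (e l k)\<^sup>2 * \<delta> k)) / \<delta> l"
    by (simp add: sum_divide_distrib sum_distrib_left sum_subtractf sum.distrib diff_divide_distrib add_divide_distrib)
  also have "\<dots> = 2 * of_bool (st l \<noteq> l) - q / \<delta> l / \<kappa>"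
    unfolding hh he ee using \<delta>_nonzero[OF assms] by (simp add: field_simps power2_eq_square)
  finally show ?thesis by (simp add: q_def add_divide_distrib diff_divide_distrib)
qed

text \<open>Summing the squared distances of the vectors \<open>b\<^sub>l - b\<^sub>l\<^sup>*\<close> from the block of \<open>\<chi>\<close> gives
  \<open>2 N - 12\<close>, where \<open>N \<le> 6\<close> is the number of nonreal basis elements. Hence all distances are zero
  and \<open>N = 6\<close>.\<close>
lemma defect_zero:
  shows antisymmetric_in_block: "\<And>l k. l < r \<Longrightarrow> k < r \<Longrightarrow> h l k = \<kappa> * \<delta> k * e l k"
    and nonreal: "\<And>l. l < r \<Longrightarrow> l \<noteq> 0 \<Longrightarrow> st l \<noteq> l"
proof -
  define E where "E l = (\<Sum>k<r. (h l k / (\<kappa> * \<delta> k) - e l k)\<^sup>2 * \<delta> k / \<delta> l)" for l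
  have term_nonneg: "(h l k / (\<kappa> * \<delta> k) - e l k)\<^sup>2 * \<delta> k / \<delta> l \<ge> 0" if "l < r" "k < r" for l k
    using \<delta>_pos[OF that(1)] \<delta>_pos[OF that(2)] by simp
  hence E_nonneg: "E l \<ge> 0" if "l < r" for l
    unfolding E_def using that by (intro sum_nonneg) auto
  have "(\<Sum>l<r. g (st l) (st l) / \<delta> l) = (\<Sum>l<r. g (st l) (st l) / \<delta> (st l))"
    by (intro sum.cong refl) simp
  also have "\<dots> = 4 * \<kappa>" using g_trace sum_st[of "\<lambda>l. g l l / \<delta> l"] by simp
  finally have gs: "(\<Sum>l<r. g (st l) (st l) / \<delta> l) = 4 * \<kappa>" .
  \<comment> \<open>\<open>b\<close> marks the real basis elements other than the identity; it is 0
    at 0 because \<open>st 0 = 0\<close>.\<close>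
  define b :: "nat \<Rightarrow> real" where "b l = of_bool (l \<noteq> 0) - of_bool (st l \<noteq> l)" for l
  have b_nonneg: "b l \<ge> 0" for l by (cases "l = 0") (auto simp: b_def)
  have "(\<Sum>l<r. E l) = (\<Sum>l<r. 2 * of_bool (st l \<noteq> l)
      - (g l l / \<delta> l - 2 * (g l (st l) / \<delta> l) + g (st l) (st l) / \<delta> l) / \<kappa>)"
    unfolding E_def by (intro sum.cong refl projection_defect) simp
  also have "\<dots> = 2 * (\<Sum>l<r. of_bool (st l \<noteq> l)) - (4 * \<kappa> - 2 * (- 2 * \<kappa>) + 4 * \<kappa>) / \<kappa>"
    unfolding sum_subtractf sum_divide_distrib[symmetric] sum.distrib sum_distrib_left[symmetric]
      g_trace g_star_trace gs ..
  also have "(\<Sum>l<r. of_bool (st l \<noteq> l)) = (\<Sum>l<r. of_bool (l \<noteq> 0)) - (\<Sum>l<r. b l)"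
    by (simp add: b_def sum_subtractf)
  also have "(\<Sum>l<r. of_bool (l \<noteq> 0)) = (6 :: real)"
    unfolding r7 by (simp add: eval_nat_numeral)
  finally have total: "(\<Sum>l<r. E l) + 2 * (\<Sum>l<r. b l) = 0"
    by simp
  have "(\<Sum>l<r. E l) \<ge> 0" "(\<Sum>l<r. b l) \<ge> 0"
    using E_nonneg b_nonneg by (auto intro!: sum_nonneg)
  with total have "(\<Sum>l<r. E l) = 0" "(\<Sum>l<r. b l) = 0" by linarith+
  hence E0: "E l = 0" and b0: "b l = 0" if "l < r" for l
    using sum_nonneg_eq_0_iff[of "{..<r}" E] sum_nonneg_eq_0_iff[of "{..<r}" b] E_nonneg b_nonneg that
    by auto
  show "st l \<noteq> l" if "l < r" "l \<noteq> 0" for l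
    using b0[OF that(1)] that(2) by (auto simp: b_def)
  fix l k assume lk: "l < r" "k < r"
  have "(\<Sum>k<r. (h l k / (\<kappa> * \<delta> k) - e l k)\<^sup>2 * \<delta> k / \<delta> l) = 0"
    using E0 lk by (simp add: E_def)
  hence "(h l k / (\<kappa> * \<delta> k) - e l k)\<^sup>2 * \<delta> k / \<delta> l = 0"
    using term_nonneg lk by (subst (asm) sum_nonneg_eq_0_iff) auto
  hence "h l k / (\<kappa> * \<delta> k) = e l k"
    using \<delta>_nonzero lk by simp
  thus "h l k = \<kappa> * \<delta> k * e l k"
    using \<delta>_nonzero lk by (simp add: field_simps)
qed

text \<open>The coefficient of \<open>b\<^sub>j\<close> in \<open>b\<^sub>i (b\<^sub>j - b\<^sub>j\<^sup>*)\<close>, computed in the block of \<open>\<chi>\<close>, where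
  \<open>X = b\<^sub>j - b\<^sub>j\<^sup>*\<close> is traceless and \<open>X\<^sup>2\<close> is scalar.\<close>
lemma half_character:
  assumes ij: "i < r" "j < r" "j \<noteq> 0" "j \<noteq> i" "j \<noteq> st i"
  shows "lam i j j - lam i (st j) j = t i / 2"
proof -
  define X where "X a b = R j a b - R (st j) a b" for a b
  have sj: "st j < r" "st i < r" using ij by simp_all
  have hX: "of_real (h j k) = (\<Sum>a<2. \<Sum>b<2. X a b * R (st k) b a)" if "k < r" for k
  proof -
    have "complex_of_real (h j k) = G j k - G (st j) k" using that ij sj by (simp add: h_def G_g)
    thus ?thesis by (simp add: G_def X_def sum_lessThan_two algebra_simps)
  qed
  \<comment> \<open>The difference is a coordinate of a product with \<open>e j\<close>, which may
    be replaced by its projection since it lies in the block.\<close>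
  have "lam i j j - lam i (st j) j = (\<Sum>k<r. e j k * lam i k j)"
    using ij sj by (simp only: e_def left_diff_distrib sum_subtractf sum_of_bool_eq_left)
  also have "\<dots> = (\<Sum>k<r. h j k * (lam i k j / \<delta> k) / \<kappa>)"
    using ij \<delta>_nonzero by (intro sum.cong refl) (simp add: antisymmetric_in_block)
  also have "\<dots> = (\<Sum>k<r. h j k * lam (st j) i (st k) / (\<kappa> * \<delta> j))"
    using ij by (intro sum.cong refl) (simp add: lam_rotate_right[of i _ j] mult.commute)
  finally have "complex_of_real (lam i j j - lam i (st j) j)
      = (\<Sum>k<r. of_real (h j k) * c (st j) i (st k)) / (of_real \<kappa> * D j)"
    by (simp add: sum_divide_distrib)
  also have "(\<Sum>k<r. of_real (h j k) * c (st j) i (st k))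
      = (\<Sum>a<2. \<Sum>b<2. X a b * (\<Sum>k<r. c (st j) i (st k) * R (st k) b a))"
    by (simp add: hX sum_lessThan_two sum.distrib sum_distrib_left algebra_simps)
  also have "\<dots> = (\<Sum>a<2. \<Sum>b<2. X a b * (\<Sum>k<r. c (st j) i k * R k b a))"
    by (simp only: sum_st[of "\<lambda>k. c (st j) i k * R k _ _"])
  also have "\<dots> = (\<Sum>a<2. \<Sum>b<2. X a b * (\<Sum>e<2. R (st j) b e * R i e a))"
    using ij sj by (simp add: R_mult)
  finally have coeff: "complex_of_real (lam i j j - lam i (st j) j)
      = (\<Sum>a<2. \<Sum>b<2. X a b * (\<Sum>e<2. R (st j) b e * R i e a)) / (of_real \<kappa> * D j)" .
  \<comment> \<open>This is where \<open>j\<close> lying outside the pair of \<open>i\<close>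
    enters: \<open>X\<close> is trace-orthogonal to \<open>R i\<close>.\<close>
  have "h j (st i) = 0"
    using ij sj by (auto simp: antisymmetric_in_block e_def st_eq_iff)
  hence XRi: "(\<Sum>a<2. \<Sum>b<2. X a b * R i b a) = 0"
    using hX[OF sj(2)] ij by simp
  have "h j j = \<kappa> * \<delta> j"
    using ij nonreal[of j] by (simp add: antisymmetric_in_block e_def)
  hence XRj: "(\<Sum>a<2. \<Sum>b<2. X a b * R (st j) b a) = of_real \<kappa> * D j"
    using hX[OF ij(2)] by simp
  \<comment> \<open>By \<open>R_star\<close>, \<open>R (st j)\<close> is half of
    \<open>\<chi> j\<close> times the identity minus \<open>X\<close>; since \<open>X\<close>
    squared is scalar, the trace of \<open>X * R (st j) * R i\<close> splits.\<close>
  have "2 * (\<Sum>a<2. \<Sum>b<2. X a b * (\<Sum>e<2. R (st j) b e * R i e a))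
      = \<chi> j * (\<Sum>a<2. \<Sum>b<2. X a b * R i b a) + (\<Sum>a<2. \<Sum>b<2. X a b * R (st j) b a) * \<chi> i"
    using R_star[OF ij(2)] ij by (simp add: X_def \<chi>_eq sum_lessThan_two algebra_simps)
  also have "\<dots> = of_real \<kappa> * D j * of_real (t i)" unfolding XRi XRj using ij by (simp add: \<chi>_real)
  finally have "(\<Sum>a<2. \<Sum>b<2. X a b * (\<Sum>e<2. R (st j) b e * R i e a)) = of_real \<kappa> * D j * of_real (t i) / 2"
    by (simp add: mult.commute[of _ 2])
  hence "complex_of_real (lam i j j - lam i (st j) j) = of_real (t i / 2)"
    unfolding coeff using \<delta>_nonzero[OF ij(2)] by simp
  thus ?thesis by (simp only: of_real_eq_iff)
qed

text \<open>The condition \<open>i < st i\<close> selects one index from each conjugate pair. Paired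
  values agree, \<open>t 0 = 2\<close>, and the total sum of \<open>t\<close> is zero.\<close>

lemma sum_half_characters: "(\<Sum>i<r. of_bool (i < st i) * (t i / 2)) = - 1 / 2"
proof -
  have "t i = of_bool (i = 0) * t i + of_bool (i < st i) * t i + of_bool (st i < i) * t i" if "i < r" for i
    using nonreal[OF that] by (cases "i = 0") (auto simp: not_less_iff_gr_or_eq)
  hence "(\<Sum>i<r. t i) = (\<Sum>i<r. of_bool (i = 0) * t i + of_bool (i < st i) * t i + of_bool (st i < i) * t i)"
    by (intro sum.cong refl) simp
  also have "\<dots> = t 0 + (\<Sum>i<r. of_bool (i < st i) * t i) + (\<Sum>i<r. of_bool (st i < i) * t i)"
    using r_pos by (simp only: sum.distrib sum_of_bool_eq_left)
  also have "(\<Sum>i<r. of_bool (st i < i) * t i) = (\<Sum>i<r. of_bool (st (st i) < st i) * t (st i))"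
    by (rule sum_st[symmetric])
  also have "\<dots> = (\<Sum>i<r. of_bool (i < st i) * t i)"
    by (intro sum.cong refl) (simp add: t_star)
  finally have "(\<Sum>i<r. t i) = 2 + 2 * (\<Sum>i<r. of_bool (i < st i) * t i)"
    by (simp add: t_def \<chi>_0)
  moreover have "complex_of_real (\<Sum>i<r. t i) = 0"
    using sum_\<chi>_eq_0 by (simp add: \<chi>_real)
  hence "(\<Sum>i<r. t i) = 0" by (simp only: of_real_eq_0_iff)
  ultimately have "(\<Sum>i<r. of_bool (i < st i) * t i) = - 1" by simp
  thus ?thesis by (simp flip: sum_divide_distrib)
qed

lemma not_all_algebraic_integers:
  shows "\<exists>i<r. \<exists>j<r. \<exists>k<r. \<not> algebraic_int (lam i j k)"
proof (rule ccontr)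
  assume "\<not> ?thesis"
  hence int: "algebraic_int (lam i j k)" if "i < r" "j < r" "k < r" for i j k
    using that by blast
  have "algebraic_int (of_bool (i < st i) * (t i / 2))" if i: "i < r" for i
  proof -
    \<comment> \<open>At most three of the seven indices are excluded, so an admissible
      \<open>j\<close> for \<open>half_character\<close> exists.\<close>
    have "card {0, i, st i} < card {..<r}"
      using card_insert_le_m1[of 3 "{i, st i}" 0] r7 by (simp add: card_insert_if)
    hence "\<not> {..<r} \<subseteq> {0, i, st i}"
      using card_mono[of "{0, i, st i}" "{..<r}"] by auto
    then obtain j where "j < r" "j \<noteq> 0" "j \<noteq> i" "j \<noteq> st i" by blast
    hence "algebraic_int (t i / 2)"
      using algebraic_int_diff[OF int[of i j j] int[of i "st j" j]] i by (simp add: half_character)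
    thus ?thesis by (cases "i < st i") auto
  qed
  hence "algebraic_int (\<Sum>i<r. of_bool (i < st i) * (t i / 2))"
    by (intro algebraic_int_sum) simp
  hence "algebraic_int (1 / 2 :: real)"
    unfolding sum_half_characters by simp
  thus False using not_algebraic_int_half by blast
qed

end

theorem theorem2:
  fixes lam :: "nat \<Rightarrow> nat \<Rightarrow> nat \<Rightarrow> real"
    and st :: "nat \<Rightarrow> nat"
    and \<delta> :: "nat \<Rightarrow> real"
    and \<chi> :: "nat \<Rightarrow> complex"
  assumes "is_RBA 7 lam st"
    and "noncommutative_RBA 7 lam"
    and "positive_degree_map 7 lam st \<delta>"
    and "standard_basis 7 lam st \<delta>"
    and "\<chi> \<in> Irr 7 lam"
    and "\<chi> 0 = 2"
    and "FS_indicator 7 lam \<delta> \<chi> = -1"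
  shows "\<not> (\<forall>i<7. \<forall>j<7. \<forall>k<7. algebraic_integer (lam i j k))"
proof -
  interpret rba 7 lam st \<delta> by unfold_locales (use assms in simp_all)
  from rba_two_exists[OF assms(5,6)] obtain R where "rba_two 7 lam st \<delta> R \<chi> (sqnorm \<chi> / 2)" ..
  then interpret rba_two 7 lam st \<delta> R \<chi> "sqnorm \<chi> / 2" .
  \<comment> \<open>With multiplicity \<open>n / \<kappa>\<close> and \<open>\<chi> 0 = 2\<close>
    the indicator is this sum divided by \<open>2 * \<kappa>\<close>, where
    \<open>\<kappa> = sqnorm \<chi> / 2\<close>.\<close>
  have "(\<Sum>i<7. (\<Sum>k<7. c i i k * \<chi> k) / D i) = - 2 * of_real (sqnorm \<chi> / 2)"
    using assms(7) \<kappa>_pos n_pos unfolding FS_indicator_def multiplicity_\<chi>[OF refl refl] assms(6)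
    by (simp add: field_simps)
  then interpret rba_quaternionic 7 lam st \<delta> R \<chi> "sqnorm \<chi> / 2"
    by unfold_locales simp_all
  show ?thesis
    using not_all_algebraic_integers unfolding algebraic_integer_iff_algebraic_int by blast
qed

end
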